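(* Let $1\le p\le 2$ and $\alpha>1$, and let $\mu$ be a positive Borel measure on $[0,1)$ which is a $\frac{2-(p-1)^{2}}{p}$-Carleson measure. Then $\mathcal{H}_{\mu}^{\alpha}$ is a bounded operator on $A^{p}$ if and only if $\mu$ is an $(\alpha+1)$-Carleson measure.
   Context: $\mathbb{D}$ is the open unit disk in $\mathbb{C}$, $H(\mathbb{D})$ is the space of analytic functions on $\mathbb{D}$, and $dA=\frac{dx\,dy}{\pi}$. For $0<p<\infty$, the Bergman space $A^{p}$ consists of all $f\in H(\mathbb{D})$ with $\|f\|_{A^{p}}=\left(\int_{\mathbb{D}}|f(z)|^{p}dA(z)\right)^{1/p}<\infty$. For $s>0$, a positive Borel measure $\mu$ on $[0,1)$ is an $s$-Carleson measure if there is $M>0$ with $\mu([t,1))\le M(1-t)^{s}$ for all $0\le t<1$. Put $\mu_{n}=\int_{[0,1)}t^{n}d\mu(t)$ and $\mu_{n,k}=\mu_{n+k}$ for $n,k\ge 0$. For $\alpha>-1$ and $f(z)=\sum_{k=0}^{\infty}a_{k}z^{k}\in H(\mathbb{D})$, define $$\mathcal{H}_{\mu}^{\alpha}(f)(z)=\sum_{n=0}^{\infty}\frac{\Gamma(n+1+\alpha)}{\Gamma(n+1)\Gamma(\alpha+1)}\left(\sum_{k=0}^{\infty}\mu_{n,k}a_{k}\right)z^{n},\quad z\in\mathbb{D},$$ whenever the inner series converge and the power series converges in $\mathbb{D}$. That $\mathcal{H}_{\mu}^{\alpha}$ is bounded on $A^p$ means that $\mathcal{H}_\mu^\alpha(f)$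 is well defined in this sense and belongs to $A^p$ for every $f\in A^p$, and there is $C>0$ with $\|\mathcal{H}_{\mu}^{\alpha}(f)\|_{A^p}\le C\|f\|_{A^p}$ for all $f\in A^p$. *)

theory Defs
  imports "HOL-Complex_Analysis.Complex_Analysis"
begin

text \<open>Functions in \<open>H(\<D>)\<close> are represented by total functions on \<^typ>\<open>complex\<close>;
  every notion below depends only on their values on the open disk \<^term>\<open>ball 0 1 :: complex set\<close>.\<close>

definition disk_area :: "complex measure" where
  "disk_area = density (restrict_space lborel (ball 0 1)) (\<lambda>_. ennreal (1 / pi))"

definition bergman_space :: "real \<Rightarrow> (complex \<Rightarrow> complex) set" where
  "bergman_space p =
     {f. f holomorphic_on ball 0 1 \<and> integrable disk_area (\<lambda>z. cmod (f z) powr p)}"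

definition bergman_norm :: "real \<Rightarrow> (complex \<Rightarrow> complex) \<Rightarrow> real" where
  "bergman_norm p f = (\<integral>z. cmod (f z) powr p \<partial>disk_area) powr (1 / p)"

definition borel_measure_on_01 :: "real measure \<Rightarrow> bool" where
  "borel_measure_on_01 \<mu> \<longleftrightarrow> sets \<mu> = sets (restrict_space borel {0..<1})"

text \<open>The bound at \<open>t = 0\<close> forces a Carleson measure to be finite, so finiteness need not be
  part of the notion of a measure.\<close>

definition carleson_measure :: "real \<Rightarrow> real measure \<Rightarrow> bool" where
  "carleson_measure s \<mu> \<longleftrightarrow>
     (\<exists>M>0. \<forall>t\<in>{0..<1}. emeasure \<mu> {t..<1} \<le> ennreal (M * (1 - t) powr s))"

definition moment :: "real measure \<Rightarrow> nat \<Rightarrow> real" where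
  "moment \<mu> n = (\<integral>t. t ^ n \<partial>\<mu>)"

definition taylor_coeff :: "(complex \<Rightarrow> complex) \<Rightarrow> nat \<Rightarrow> complex" where
  "taylor_coeff f k = fps_nth (fps_expansion f 0) k"

definition hilbert_coeff :: "real measure \<Rightarrow> real \<Rightarrow> (complex \<Rightarrow> complex) \<Rightarrow> nat \<Rightarrow> complex" where
  "hilbert_coeff \<mu> \<alpha> f n =
     of_real (Gamma (real n + 1 + \<alpha>) / (Gamma (real n + 1) * Gamma (\<alpha> + 1)))
       * (\<Sum>k. of_real (moment \<mu> (n + k)) * taylor_coeff f k)"

definition hilbert_op :: "real measure \<Rightarrow> real \<Rightarrow> (complex \<Rightarrow> complex) \<Rightarrow> complex \<Rightarrow> complex" where
  "hilbert_op \<mu> \<alpha> f z = (\<Sum>n. hilbert_coeff \<mu> \<alpha> f n * z ^ n)"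

definition hilbert_op_defined :: "real measure \<Rightarrow> real \<Rightarrow> (complex \<Rightarrow> complex) \<Rightarrow> bool" where
  "hilbert_op_defined \<mu> \<alpha> f \<longleftrightarrow>
     (\<forall>n. summable (\<lambda>k. of_real (moment \<mu> (n + k)) * taylor_coeff f k)) \<and>
     (\<forall>z\<in>ball 0 1. summable (\<lambda>n. hilbert_coeff \<mu> \<alpha> f n * z ^ n))"

definition hilbert_op_bounded_on_bergman :: "real measure \<Rightarrow> real \<Rightarrow> real \<Rightarrow> bool" where
  "hilbert_op_bounded_on_bergman \<mu> \<alpha> p \<longleftrightarrow>
     (\<forall>f\<in>bergman_space p. hilbert_op_defined \<mu> \<alpha> f \<and> hilbert_op \<mu> \<alpha> f \<in> bergman_space p) \<and>
     (\<exists>C>0. \<forall>f\<in>bergman_space p.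
        bergman_norm p (hilbert_op \<mu> \<alpha> f) \<le> C * bergman_norm p f)"

end

theory Submission
  imports Defs
begin

text \<open>
The proof rests on the representation

  \<open>hilbert_op \<mu> \<alpha> f z = (\<integral>t. f t * (1 - t * z) powr (- (\<alpha> + 1)) \<partial>\<mu>)\<close>

(lemma \<open>hilbert_op_integral_representation\<close>) and on the comparison of \<open>cmod (1 - t * z)\<close> with
\<open>max (1 - t) (cmod (1 - z))\<close>, which reduces every kernel estimate to one dyadic computation
(lemma \<open>nn_integral_power_kernel_le\<close>).

If the operator is bounded, it is tested on \<open>f z = 1 / (1 - b * z) ^ 3\<close> at the point \<open>z = b\<close>. The
integrand is positive there and already the part over \<open>{b..<1}\<close> contributes the mass of this
interval times \<open>(1 - b) powr (- (\<alpha> + 4))\<close>, while the growth of functions in the Bergman space allows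
no more than a multiple of \<open>(1 - b) powr (- 3)\<close>. This is the Carleson condition of order
\<open>\<alpha> + 1\<close> (theorem \<open>carleson_measure_if_bounded\<close>).

Conversely, let \<open>\<mu>\<close> be a Carleson measure of order \<open>\<alpha> + 1 > 2\<close>. Taylor coefficients of Bergman
functions grow at most linearly and \<open>\<Sum>k. (k + 1) * moment \<mu> k\<close> converges, so the operator is
defined and the representation holds. A Schur test with weight \<open>1 / (1 - t)\<close> bounds
\<open>cmod (hilbert_op \<mu> \<alpha> f z) powr p\<close> by an integral of \<open>cmod (f t) powr p\<close> over \<open>t\<close>; integrating
over the disk leaves the integral of \<open>cmod (f t) powr p * (1 - t) powr (1 - \<alpha>)\<close> with respect to
\<open>\<mu>\<close>. The weighted measure \<open>(1 - t) powr (1 - \<alpha>) d\<mu>\<close> satisfies the Carleson condition of order 2,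
which is the one that embeds the Bergman space (lemma \<open>carleson_embedding\<close>, theorem
\<open>bounded_if_carleson_measure\<close>).

The facts about the Bergman space used on the way are pointwise and coefficient bounds. Both come
from orthogonality of the monomials on disks, which follows from rotation invariance of plane area.
\<close>

section \<open>Rotation invariance of plane area\<close>

lemma lborel_complex_eq_distr:
  "(lborel :: complex measure) = distr (lborel \<Otimes>\<^sub>M lborel) borel (\<lambda>(x, y). Complex x y)"
proof (rule lborel_eqI)
  fix l u :: complex
  assume le: "\<And>b. b \<in> Basis \<Longrightarrow> l \<bullet> b \<le> u \<bullet> b"
  have le': "Re l \<le> Re u" "Im l \<le> Im u"
    using le[of 1] le[of \<i>] by (auto simp: Basis_complex_def)
  have meas: "(\<lambda>(x, y). Complex x y) \<in> borel_measurable (lborel \<Otimes>\<^sub>M lborel)"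
    by (simp add: Complex_eq split_def)
  have vim: "(\<lambda>(x, y). Complex x y) -` box l u \<inter> space (lborel \<Otimes>\<^sub>M lborel)
      = {Re l<..<Re u} \<times> {Im l<..<Im u}"
    by (auto simp: box_def Basis_complex_def space_pair_measure)
  show "emeasure (distr (lborel \<Otimes>\<^sub>M lborel) borel (\<lambda>(x, y). Complex x y)) (box l u)
      = (\<Prod>b\<in>Basis. (u - l) \<bullet> b)"
    using le' by (simp add: emeasure_distr[OF meas] vim lborel.emeasure_pair_measure_Times
        Basis_complex_def ennreal_mult)
qed simp

lemma borel_measurable_Complex [measurable]:
  assumes "f \<in> borel_measurable M" "g \<in> borel_measurable M"
  shows "(\<lambda>x. Complex (f x) (g x)) \<in> borel_measurable M"
  using assms by (simp add: Complex_eq)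

lemma nn_integral_complex_iterated:
  fixes f :: "complex \<Rightarrow> ennreal"
  assumes [measurable]: "f \<in> borel_measurable borel"
  shows "(\<integral>\<^sup>+z. f z \<partial>lborel) = (\<integral>\<^sup>+x. \<integral>\<^sup>+y. f (Complex x y) \<partial>lborel \<partial>lborel)"
    and "(\<integral>\<^sup>+z. f z \<partial>lborel) = (\<integral>\<^sup>+y. \<integral>\<^sup>+x. f (Complex x y) \<partial>lborel \<partial>lborel)"
proof -
  have *: "(\<integral>\<^sup>+z. f z \<partial>lborel) = (\<integral>\<^sup>+w. f (Complex (fst w) (snd w)) \<partial>(lborel \<Otimes>\<^sub>M lborel))"
    by (subst lborel_complex_eq_distr, subst nn_integral_distr) (auto simp: split_def)
  show "(\<integral>\<^sup>+z. f z \<partial>lborel) = (\<integral>\<^sup>+x. \<integral>\<^sup>+y. f (Complex x y) \<partial>lborel \<partial>lborel)"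
    unfolding * by (subst lborel.nn_integral_fst[symmetric]) auto
  show "(\<integral>\<^sup>+z. f z \<partial>lborel) = (\<integral>\<^sup>+y. \<integral>\<^sup>+x. f (Complex x y) \<partial>lborel \<partial>lborel)"
    unfolding * by (subst lborel_pair.nn_integral_snd[symmetric]) auto
qed

lemma nn_integral_lborel_translate:
  fixes f :: "'a::euclidean_space \<Rightarrow> ennreal"
  assumes [measurable]: "f \<in> borel_measurable borel"
  shows "(\<integral>\<^sup>+x. f (c + x) \<partial>lborel) = (\<integral>\<^sup>+x. f x \<partial>lborel)"
proof -
  have "(\<integral>\<^sup>+x. f x \<partial>lborel) = (\<integral>\<^sup>+x. f x \<partial>distr lborel borel ((+) c))"
    by (simp add: lborel_distr_plus)
  also have "\<dots> = (\<integral>\<^sup>+x. f (c + x) \<partial>lborel)"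
    by (subst nn_integral_distr) auto
  finally show ?thesis ..
qed

text \<open>On each horizontal (or vertical) line a shear acts as a translation, so Tonelli reduces the claim
to translation invariance on the real line.\<close>

lemma nn_integral_shear:
  fixes f :: "complex \<Rightarrow> ennreal" and a :: real
  assumes [measurable]: "f \<in> borel_measurable borel"
  shows "(\<integral>\<^sup>+z. f (Complex (Re z + a * Im z) (Im z)) \<partial>lborel) = (\<integral>\<^sup>+z. f z \<partial>lborel)"
    and "(\<integral>\<^sup>+z. f (Complex (Re z) (Im z + a * Re z)) \<partial>lborel) = (\<integral>\<^sup>+z. f z \<partial>lborel)"
proof -
  have "(\<integral>\<^sup>+x. f (Complex (x + a * y) y) \<partial>lborel) = (\<integral>\<^sup>+x. f (Complex x y) \<partial>lborel)" for y
    using nn_integral_lborel_translate[of "\<lambda>x. f (Complex x y)" "a * y"] by (simp add: add.commute)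
  then show "(\<integral>\<^sup>+z. f (Complex (Re z + a * Im z) (Im z)) \<partial>lborel) = (\<integral>\<^sup>+z. f z \<partial>lborel)"
    by (simp add: nn_integral_complex_iterated(2))
  have "(\<integral>\<^sup>+y. f (Complex x (y + a * x)) \<partial>lborel) = (\<integral>\<^sup>+y. f (Complex x y) \<partial>lborel)" for x
    using nn_integral_lborel_translate[of "\<lambda>y. f (Complex x y)" "a * x"] by (simp add: add.commute)
  then show "(\<integral>\<^sup>+z. f (Complex (Re z) (Im z + a * Re z)) \<partial>lborel) = (\<integral>\<^sup>+z. f z \<partial>lborel)"
    by (simp add: nn_integral_complex_iterated(1))
qed

text \<open>A rotation off the real axis is a product of three shears (the lifting decomposition), and each of
them preserves area.\<close>

lemma distr_lborel_rotation:
  fixes u :: complex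
  assumes u: "cmod u = 1" and "Im u \<noteq> 0"
  shows "distr lborel borel (\<lambda>z. u * z) = lborel"
proof (rule measure_eqI)
  fix A assume "A \<in> sets (distr lborel borel (\<lambda>z. u * z))"
  then have A [measurable]: "A \<in> sets borel" by simp
  \<comment> \<open>horizontal shear by \<open>a\<close>, vertical shear by \<open>b\<close>, horizontal shear by \<open>a\<close>\<close>
  define a b where "a = (Re u - 1) / Im u" and "b = Im u"
  define S where "S c z = Complex (Re z + c * Im z) (Im z)" for c z
  define T where "T c z = Complex (Re z) (Im z + c * Re z)" for c z
  have [measurable]: "S c \<in> borel_measurable borel" "T c \<in> borel_measurable borel" for c
    unfolding S_def T_def by measurable
  have sq: "(Re u)\<^sup>2 + (Im u)\<^sup>2 = 1"
    using u by (metis cmod_power2 one_power2)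
  have ab: "1 + a * b = Re u"
    using assms by (simp add: a_def b_def)
  have aa: "a * (1 + Re u) = - Im u"
    using assms sq by (simp add: a_def field_simps power2_eq_square)
  have rot: "u * z = S a (T b (S a z))" for z
  proof (rule complex_eqI)
    have "Re (S a (T b (S a z))) = (1 + a * b) * Re z + (a * (1 + (1 + a * b))) * Im z"
      by (simp add: S_def T_def algebra_simps)
    then show "Re (u * z) = Re (S a (T b (S a z)))"
      unfolding ab aa by simp
    have "Im (S a (T b (S a z))) = (1 + a * b) * Im z + b * Re z"
      by (simp add: S_def T_def algebra_simps)
    then show "Im (u * z) = Im (S a (T b (S a z)))"
      unfolding ab by (simp add: b_def)
  qed
  have "emeasure (distr lborel borel (\<lambda>z. u * z)) A = (\<integral>\<^sup>+z. indicator A (u * z) \<partial>lborel)"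
    using nn_integral_distr[of "\<lambda>z. u * z" lborel borel "indicator A"] by simp
  also have "\<dots> = (\<integral>\<^sup>+z. indicator A (S a (T b (S a z))) \<partial>lborel)"
    by (simp add: rot)
  also have "\<dots> = (\<integral>\<^sup>+z. indicator A (S a (T b z)) \<partial>lborel)"
    using nn_integral_shear(1)[of "\<lambda>z. indicator A (S a (T b z))" a] by (simp add: S_def)
  also have "\<dots> = (\<integral>\<^sup>+z. indicator A (S a z) \<partial>lborel)"
    using nn_integral_shear(2)[of "\<lambda>z. indicator A (S a z)" b] by (simp add: T_def)
  also have "\<dots> = (\<integral>\<^sup>+z. indicator A z \<partial>lborel)"
    using nn_integral_shear(1)[of "\<lambda>z. indicator A z" a] by (simp add: S_def)
  finally show "emeasure (distr lborel borel (\<lambda>z. u * z)) A = emeasure lborel A"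
    by simp
qed simp

lemma borel_measurable_cnj [measurable]: "cnj \<in> borel_measurable borel"
  by (intro borel_measurable_continuous_onI continuous_on_cnj continuous_on_id)

text \<open>Rotating the disk by \<open>u\<close> multiplies the integral by \<open>u ^ m * cnj u ^ k\<close>; for \<open>m \<noteq> k\<close> the
angle can be chosen so that this factor is \<open>\<i>\<close>, and then the integral vanishes.\<close>

lemma integral_ball_monomials_orthogonal:
  fixes m k :: nat and r :: real
  assumes "m \<noteq> k"
  shows "(\<integral>z. indicator (ball 0 r) z *\<^sub>R (z ^ m * cnj z ^ k) \<partial>lborel) = (0 :: complex)"
    (is "?I = 0")
proof -
  \<comment> \<open>The factor is then a quarter turn, and \<open>0 < \<bar>\<theta>\<bar> \<le> pi / 2\<close> keeps \<open>cis \<theta>\<close> off the real axis.\<close>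
  define \<theta> where "\<theta> = pi / (2 * (real m - real k))"
  define u where "u = cis \<theta>"
  have mk: "\<bar>real m - real k\<bar> \<ge> 1"
    using assms by linarith
  then have "\<bar>\<theta>\<bar> \<le> pi / 2" "\<theta> \<noteq> 0"
    by (auto simp: \<theta>_def abs_mult field_simps)
  then have "sin \<theta> \<noteq> 0"
    using sin_eq_0_pi[of \<theta>] pi_gt_zero by (smt (verit, best) field_sum_of_halves)
  then have Im: "Im u \<noteq> 0" and n: "cmod u = 1"
    by (simp_all add: u_def)
  have "u ^ m * cnj u ^ k = cis (\<theta> * (real m - real k))"
    by (simp add: u_def cis_cnj Complex.DeMoivre cis_mult algebra_simps)
  also have "\<theta> * (real m - real k) = pi / 2"
    using mk by (auto simp: \<theta>_def field_simps)
  finally have uu: "u ^ m * cnj u ^ k = \<i>"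
    by simp
  have meas: "(\<lambda>z. indicator (ball 0 r) z *\<^sub>R (z ^ m * cnj z ^ k)) \<in> borel_measurable borel"
    by (intro borel_measurable_scaleR borel_measurable_indicator borel_measurable_times borel_measurable_power) auto
  have "?I = (\<integral>z. indicator (ball 0 r) z *\<^sub>R (z ^ m * cnj z ^ k) \<partial>distr lborel borel (\<lambda>z. u * z))"
    by (simp add: distr_lborel_rotation[OF n Im])
  also have "\<dots> = (\<integral>z. indicator (ball 0 r) (u * z) *\<^sub>R ((u * z) ^ m * cnj (u * z) ^ k) \<partial>lborel)"
    using meas by (subst integral_distr) auto
  also have "\<dots> = (\<integral>z. (u ^ m * cnj u ^ k) * (indicator (ball 0 r) z *\<^sub>R (z ^ m * cnj z ^ k)) \<partial>lborel)"
    by (intro Bochner_Integration.integral_cong refl)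
       (auto simp: indicator_def norm_mult n power_mult_distrib mult_ac)
  also have "\<dots> = \<i> * ?I"
    unfolding uu by (rule integral_mult_right_zero)
  finally have I: "?I = \<i> * ?I" .
  have "J = 0" if J: "J = \<i> * J" for J :: complex
  proof -
    have "Re J = - Im J" "Im J = Re J"
      by (subst J, simp)+
    then show ?thesis
      by (intro complex_eqI) auto
  qed
  from this[OF I] show ?thesis .
qed

section \<open>Area means of holomorphic functions\<close>

lemma sets_borel_balls [measurable]:
  "ball (c :: 'a::metric_space) r \<in> sets borel" "cball c r \<in> sets borel"
  by auto

lemma measure_lborel_complex_ball:
  "0 \<le> r \<Longrightarrow> measure lborel (ball c r) = pi * r\<^sup>2" for c :: complex
  by (simp add: content_ball unit_ball_vol_2)

lemma integrable_indicator_ball: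
  fixes f :: "complex \<Rightarrow> 'b :: {banach, second_countable_topology}"
  assumes "f \<in> borel_measurable borel" "\<And>z. z \<in> ball c r \<Longrightarrow> norm (f z) \<le> B"
  shows "integrable lborel (\<lambda>z. indicator (ball c r) z *\<^sub>R f z)"
  using assms by (intro integrableI_bounded_set_indicator[where B = B])
     (auto simp: emeasure_lborel_ball_finite[unfolded infinity_ennreal_def])

text \<open>Integrating the Taylor series against \<open>cnj z ^ k\<close> over a disk isolates the \<open>k\<close>-th coefficient,
since the monomials are orthogonal there. The case \<open>k = 0\<close> is the area mean value property and
the general case gives the growth of Taylor coefficients in Bergman spaces.\<close>

lemma integral_ball_times_cnj_power:
  fixes f :: "complex \<Rightarrow> complex"
  assumes holf: "f holomorphic_on ball 0 R" and r: "0 < r" "r < R"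
  shows "(\<integral>z. indicator (ball 0 r) z *\<^sub>R (f z * cnj z ^ k) \<partial>lborel)
    = (deriv ^^ k) f 0 / fact k
        * of_real (\<integral>z. indicator (ball 0 r) z *\<^sub>R cmod z ^ (2 * k) \<partial>lborel)"
proof -
  define a where "a n = (deriv ^^ n) f 0 / fact n" for n
  define F where "F n z = indicator (ball 0 r) z *\<^sub>R (a n * z ^ n * cnj z ^ k)" for n z
  have sums: "(\<lambda>n. a n * z ^ n) sums f z" if "z \<in> ball 0 R" for z
    using holomorphic_power_series[OF holf that] by (simp add: a_def)
  obtain s where s: "r < s" "s < R"
    using r dense by blast
  have "summable (\<lambda>n. a n * of_real s ^ n)"
    using sums[of "of_real s"] r s by (simp add: sums_iff)
  then have "summable (\<lambda>n. norm (a n * of_real r ^ n))"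
    using r s by (intro powser_insidea[of _ "of_real s"]) auto
  then have summ: "summable (\<lambda>n. cmod (a n) * r ^ n * r ^ k)"
    using r by (intro summable_mult2) (simp add: norm_mult norm_power)
  have bound: "cmod (a n * z ^ n * cnj z ^ k) \<le> cmod (a n) * r ^ n * r ^ k"
    if "z \<in> ball 0 r" for n z
    using that r by (auto simp: norm_mult norm_power intro!: mult_mono power_mono)
  have int: "integrable lborel (F n)" for n
    unfolding F_def by (rule integrable_indicator_ball[OF _ bound]) measurable
  have normF: "norm (F n z) \<le> cmod (a n) * r ^ n * r ^ k * indicator (ball 0 r) z" for n z
    using bound[of z n] by (auto simp: F_def indicator_def simp del: mem_ball)
  have "(\<integral>z. norm (F n z) \<partial>lborel) \<le> cmod (a n) * r ^ n * r ^ k * measure lborel (ball 0 r :: complex set)" for n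
  proof -
    have "(\<integral>z. norm (F n z) \<partial>lborel)
        \<le> (\<integral>z. cmod (a n) * r ^ n * r ^ k * indicator (ball 0 r :: complex set) z \<partial>lborel)"
      using integrable_indicator_ball[of "\<lambda>_. 1 :: real" 0 r 1]
      by (intro integral_mono integrable_norm int normF integrable_mult_right) simp_all
    also have "\<dots> = cmod (a n) * r ^ n * r ^ k * measure lborel (ball 0 r :: complex set)"
      by simp
    finally show ?thesis .
  qed
  then have summ': "summable (\<lambda>n. \<integral>z. norm (F n z) \<partial>lborel)"
    by (intro summable_comparison_test'[OF summable_mult2[OF summ]]) (simp add: integral_nonneg_AE)
  have pt: "(\<Sum>n. F n z) = indicator (ball 0 r) z *\<^sub>R (f z * cnj z ^ k)" for z
  proof (cases "z \<in> ball 0 r")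
    case True
    then have "(\<lambda>n. a n * z ^ n * cnj z ^ k) sums (f z * cnj z ^ k)"
      using r by (intro sums_mult2 sums) auto
    with True show ?thesis
      by (auto simp: F_def sums_iff)
  qed (simp add: F_def)
  have "(\<integral>z. indicator (ball 0 r) z *\<^sub>R (f z * cnj z ^ k) \<partial>lborel) = (\<Sum>n. \<integral>z. F n z \<partial>lborel)"
    unfolding pt[symmetric]
  proof (rule integral_suminf[OF int _ summ'])
    show "AE z in lborel. summable (\<lambda>n. norm (F n z))"
    proof (intro AE_I2)
      fix z :: complex
      have "norm (norm (F n z)) \<le> cmod (a n) * r ^ n * r ^ k" for n
        using bound[of z n] r by (cases "z \<in> ball 0 r") (simp_all add: F_def)
      then show "summable (\<lambda>n. norm (F n z))"
        by (rule summable_comparison_test'[OF summ])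
    qed
  qed
  also have "\<dots> = (\<Sum>n\<in>{k}. \<integral>z. F n z \<partial>lborel)"
  proof (rule suminf_finite)
    fix n assume "n \<notin> {k}"
    then have "(\<integral>z. F n z \<partial>lborel)
        = (\<integral>z. a n * (indicator (ball 0 r) z *\<^sub>R (z ^ n * cnj z ^ k)) \<partial>lborel)"
      by (simp add: F_def mult_ac)
    also have "\<dots> = a n * (\<integral>z. indicator (ball 0 r) z *\<^sub>R (z ^ n * cnj z ^ k) \<partial>lborel)"
      by (rule integral_mult_right_zero)
    finally show "(\<integral>z. F n z \<partial>lborel) = 0"
      using \<open>n \<notin> {k}\<close> by (simp add: integral_ball_monomials_orthogonal)
  qed simp
  also have "\<dots> = (\<integral>z. a k * of_real (indicator (ball 0 r) z *\<^sub>R cmod z ^ (2 * k)) \<partial>lborel)"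
  proof -
    have "z ^ k * cnj z ^ k = of_real (cmod z ^ (2 * k))" for z
      by (simp add: power_mult_distrib[symmetric] complex_norm_square[symmetric] power_mult)
    then show ?thesis
      by (simp add: F_def scaleR_conv_of_real mult_ac)
  qed
  also have "\<dots> = a k * of_real (\<integral>z. indicator (ball 0 r) z *\<^sub>R cmod z ^ (2 * k) \<partial>lborel)"
    by (subst integral_mult_right_zero) (simp only: integral_complex_of_real)
  finally show ?thesis
    by (simp add: a_def)
qed

lemma area_mean_value:
  fixes f :: "complex \<Rightarrow> complex"
  assumes holf: "f holomorphic_on ball c R" and r: "0 < r" "r < R"
  shows "(\<integral>z. indicator (ball c r) z *\<^sub>R f z \<partial>lborel) = of_real (pi * r\<^sup>2) * f c"
proof -
  have hol: "(\<lambda>z. f (c + z)) holomorphic_on ball 0 R"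
    by (rule holomorphic_on_compose_gen[OF _ holf, unfolded o_def])
       (auto intro!: holomorphic_intros simp: dist_norm)
  have cont: "continuous_on (ball c r) f"
    using holf r by (intro holomorphic_on_imp_continuous_on) (auto intro: holomorphic_on_subset)
  have meas: "(\<lambda>z. indicator (ball c r) z *\<^sub>R f z) \<in> borel_measurable borel"
    by (rule borel_measurable_continuous_on_indicator[OF _ cont]) auto
  have "(\<integral>z. indicator (ball c r) z *\<^sub>R f z \<partial>lborel)
      = (\<integral>z. indicator (ball c r) z *\<^sub>R f z \<partial>distr lborel borel ((+) c))"
    by (simp add: lborel_distr_plus)
  also have "\<dots> = (\<integral>z. indicator (ball c r) (c + z) *\<^sub>R f (c + z) \<partial>lborel)"
    using meas by (subst integral_distr) auto
  also have "\<dots> = (\<integral>z. indicator (ball 0 r) z *\<^sub>R (f (c + z) * cnj z ^ 0) \<partial>lborel)"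
    by (intro Bochner_Integration.integral_cong) (auto simp: indicator_def dist_norm)
  also have "\<dots> = f c * of_real (\<integral>z. indicator (ball 0 r :: complex set) z \<partial>lborel)"
    by (subst integral_ball_times_cnj_power[OF hol r]) simp
  also have "\<dots> = of_real (pi * r\<^sup>2) * f c"
    using r by (simp add: measure_lborel_complex_ball)
  finally show ?thesis .
qed

section \<open>A weighted Jensen inequality\<close>

text \<open>The graph of the convex function \<open>\<lambda>x. x powr p\<close> lies above its tangent at \<open>m\<close>.\<close>

lemma tangent_line_le_powr:
  fixes x m p :: real
  assumes "1 \<le> p" "0 \<le> x" "0 \<le> m"
  shows "p * m powr (p - 1) * x \<le> x powr p + (p - 1) * m powr p"
proof (cases "x = 0 \<or> m = 0")
  case False
  then have "x > 0" "m > 0" using assms by auto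
  then have "(x powr p) powr (1 / p) * (m powr p) powr (1 - 1 / p)
      \<le> 1 / p * x powr p + (1 - 1 / p) * m powr p"
    using assms by (intro Youngs_inequality_0) auto
  moreover have "p * (1 - 1 / p) = p - 1"
    using assms by (simp add: field_simps)
  ultimately have "x * m powr (p - 1) \<le> 1 / p * x powr p + (1 - 1 / p) * m powr p"
    using assms \<open>x > 0\<close> by (simp add: powr_powr)
  then have "p * (x * m powr (p - 1)) \<le> p * (1 / p * x powr p + (1 - 1 / p) * m powr p)"
    using assms by (intro mult_left_mono) auto
  also have "\<dots> = x powr p + (p - 1) * m powr p"
    using assms by (simp add: field_simps)
  finally show ?thesis
    by (simp add: mult_ac)
qed (use assms in auto)

text \<open>Jensen's inequality for the convex function \<open>\<lambda>x. x powr p\<close> and the weight \<open>h\<close>, written with a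
lower bound \<open>A\<close> for the weighted integral and an upper bound \<open>H\<close> for the total weight, so that
no integrability has to be known in advance. It is obtained by integrating the tangent inequality
at the mean value \<open>A / H\<close>. It serves both for the subharmonicity of \<open>cmod (f z) powr p\<close> and as
the Hoelder step of the Schur test.\<close>

lemma powr_weighted_integral_le:
  fixes g h :: "'a \<Rightarrow> real" and p A H :: real
  assumes p: "1 \<le> p" and [measurable]: "g \<in> borel_measurable M" "h \<in> borel_measurable M"
    and nonneg: "\<And>x. x \<in> space M \<Longrightarrow> 0 \<le> g x" "\<And>x. x \<in> space M \<Longrightarrow> 0 \<le> h x"
    and H: "0 < H" "(\<integral>\<^sup>+x. h x \<partial>M) \<le> ennreal H"
    and A: "0 \<le> A" "ennreal A \<le> (\<integral>\<^sup>+x. g x * h x \<partial>M)"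
  shows "ennreal (A powr p) \<le> ennreal (H powr (p - 1)) * (\<integral>\<^sup>+x. g x powr p * h x \<partial>M)"
proof -
  define m where "m = A / H"
  define I where "I = (\<integral>\<^sup>+x. g x powr p * h x \<partial>M)"
  have m: "0 \<le> m"
    using A H by (simp add: m_def)
  have mp: "m powr (p - 1) * A = m powr p * H"
    using H A by (cases "A = 0") (simp_all add: m_def powr_diff field_simps)
  have "ennreal (p * m powr p * H) = ennreal (p * m powr (p - 1)) * ennreal A"
    using p A mp by (simp add: ennreal_mult[symmetric] mult.assoc)
  also have "\<dots> \<le> ennreal (p * m powr (p - 1)) * (\<integral>\<^sup>+x. g x * h x \<partial>M)"
    by (intro mult_left_mono A) auto
  also have "\<dots> = (\<integral>\<^sup>+x. p * m powr (p - 1) * (g x * h x) \<partial>M)"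
    using p nonneg
    by (subst nn_integral_cmult[symmetric]) (auto intro!: nn_integral_cong simp: ennreal_mult[symmetric])
  also have "\<dots> \<le> (\<integral>\<^sup>+x. ennreal (g x powr p * h x) + ennreal ((p - 1) * m powr p) * ennreal (h x) \<partial>M)"
  proof (intro nn_integral_mono)
    fix x assume x: "x \<in> space M"
    have "p * m powr (p - 1) * g x * h x \<le> (g x powr p + (p - 1) * m powr p) * h x"
      using tangent_line_le_powr[OF p nonneg(1)[OF x] m] nonneg(2)[OF x] by (rule mult_right_mono)
    then show "ennreal (p * m powr (p - 1) * (g x * h x))
        \<le> ennreal (g x powr p * h x) + ennreal ((p - 1) * m powr p) * ennreal (h x)"
      using p nonneg[OF x]
      by (simp add: ennreal_mult[symmetric] ennreal_plus[symmetric] distrib_right mult.assoc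
          del: ennreal_plus)
  qed
  also have "\<dots> = I + ennreal ((p - 1) * m powr p) * (\<integral>\<^sup>+x. h x \<partial>M)"
    unfolding I_def by (subst nn_integral_add) (auto simp: nn_integral_cmult)
  also have "\<dots> \<le> I + ennreal ((p - 1) * m powr p) * ennreal H"
    by (intro add_mono mult_left_mono H) auto
  finally have "ennreal (p * m powr p * H) \<le> I + ennreal ((p - 1) * m powr p * H)"
    using p H by (simp add: ennreal_mult)
  then have "ennreal (m powr p * H) \<le> I"
  proof (cases I)
    case (real i)
    assume "ennreal (p * m powr p * H) \<le> I + ennreal ((p - 1) * m powr p * H)"
    then have "p * m powr p * H \<le> i + (p - 1) * m powr p * H"
      using real p H by (simp add: ennreal_plus[symmetric] del: ennreal_plus)
    then show ?thesis
      using real by (simp add: algebra_simps)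
  qed simp
  then have "ennreal (H powr (p - 1)) * ennreal (m powr p * H) \<le> ennreal (H powr (p - 1)) * I"
    by (rule mult_left_mono) auto
  moreover have "H powr (p - 1) * (m powr p * H) = A powr p"
    using A H by (simp add: m_def powr_divide powr_diff field_simps)
  ultimately show ?thesis
    using H by (simp add: I_def ennreal_mult[symmetric])
qed

section \<open>Point and coefficient estimates in the disk\<close>

lemma nn_integral_disk_area:
  assumes "g \<in> borel_measurable disk_area"
  shows "(\<integral>\<^sup>+z. g z \<partial>disk_area) = ennreal (1 / pi) * (\<integral>\<^sup>+z. g z * indicator (ball 0 1) z \<partial>lborel)"
proof -
  have g: "g \<in> borel_measurable (restrict_space lborel (ball 0 1))"
    using assms by (simp add: disk_area_def)
  have "(\<integral>\<^sup>+z. g z \<partial>disk_area) = (\<integral>\<^sup>+z. ennreal (1 / pi) * g z \<partial>restrict_space lborel (ball 0 1))"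
    unfolding disk_area_def using g by (subst nn_integral_density) auto
  also have "\<dots> = ennreal (1 / pi) * (\<integral>\<^sup>+z. g z \<partial>restrict_space lborel (ball 0 1))"
    using g by (rule nn_integral_cmult)
  finally show ?thesis
    by (simp add: nn_integral_restrict_space)
qed

lemma space_disk_area [simp]: "space disk_area = ball 0 1"
  by (simp add: disk_area_def space_restrict_space)

lemma sets_disk_area: "sets disk_area = sets (restrict_space borel (ball 0 1))"
  by (simp add: disk_area_def sets_restrict_space)

lemma id_measurable_disk_area [measurable]: "(\<lambda>z. z) \<in> measurable disk_area borel"
proof -
  have "measurable disk_area borel = measurable (restrict_space borel (ball 0 1)) (borel :: complex measure)"
    by (intro measurable_cong_sets sets_disk_area refl)
  then show ?thesis
    by (simp add: measurable_restrict_space1)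
qed

lemma continuous_on_measurable_disk_area:
  fixes f :: "complex \<Rightarrow> 'b :: topological_space"
  assumes "continuous_on (ball 0 1) f"
  shows "f \<in> measurable disk_area borel"
proof -
  have "measurable disk_area borel = measurable (restrict_space borel (ball 0 1)) (borel :: 'b measure)"
    by (intro measurable_cong_sets sets_disk_area refl)
  then show ?thesis
    using borel_measurable_continuous_on_restrict[OF assms] by simp
qed

lemma holomorphic_measurable_disk_area:
  "f holomorphic_on ball 0 1 \<Longrightarrow> f \<in> measurable disk_area borel"
  by (intro continuous_on_measurable_disk_area holomorphic_on_imp_continuous_on)

lemma emeasure_disk_area_cball_le:
  assumes "0 \<le> u"
  shows "emeasure disk_area {z \<in> space disk_area. cmod (c - z) \<le> u} \<le> ennreal (u\<^sup>2)"
proof -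
  have [measurable]: "{z \<in> space disk_area. cmod (c - z) \<le> u} \<in> sets disk_area"
    by measurable
  have "emeasure disk_area {z \<in> space disk_area. cmod (c - z) \<le> u}
      = (\<integral>\<^sup>+z. indicator {z \<in> space disk_area. cmod (c - z) \<le> u} z \<partial>disk_area)"
    by (rule nn_integral_indicator[symmetric]) measurable
  also have "\<dots> = ennreal (1 / pi) * (\<integral>\<^sup>+z. indicator {z \<in> space disk_area. cmod (c - z) \<le> u} z * indicator (ball 0 1) z \<partial>lborel)"
    by (rule nn_integral_disk_area) measurable
  also have "\<dots> \<le> ennreal (1 / pi) * (\<integral>\<^sup>+z. indicator (cball c u) z \<partial>lborel)"
    by (intro mult_left_mono nn_integral_mono) (auto simp: indicator_def dist_norm)
  also have "\<dots> = ennreal (1 / pi) * ennreal (pi * u\<^sup>2)"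
    using assms by (simp add: emeasure_cball unit_ball_vol_2)
  also have "\<dots> = ennreal (u\<^sup>2)"
    by (simp add: ennreal_mult[symmetric])
  finally show ?thesis .
qed

lemma finite_measure_disk_area: "finite_measure disk_area"
proof
  have "space disk_area = {z \<in> space disk_area. cmod (0 - z) \<le> 1}"
    by auto
  then have "emeasure disk_area (space disk_area) \<le> ennreal (1\<^sup>2)"
    using emeasure_disk_area_cball_le[of 1 0] by argo
  then show "emeasure disk_area (space disk_area) \<noteq> \<infinity>"
    by (auto simp: top_unique)
qed

lemma norm_integral_le_nn_integral:
  fixes f :: "'a \<Rightarrow> 'b :: {banach, second_countable_topology}"
  shows "ennreal (norm (\<integral>x. f x \<partial>M)) \<le> (\<integral>\<^sup>+x. norm (f x) \<partial>M)"
  by (cases "integrable M f") (auto simp: integral_norm_bound_ennreal not_integrable_integral_eq)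

text \<open>Subharmonicity of \<open>cmod (f z) powr p\<close>: Jensen's inequality applied to the area mean value
property.\<close>

lemma powr_norm_le_disk_mean:
  assumes holf: "f holomorphic_on ball 0 1" and p: "1 \<le> p"
    and r: "0 < r" "r < R" and sub: "ball c R \<subseteq> ball 0 1"
  shows "ennreal (cmod (f c) powr p * r\<^sup>2) \<le> (\<integral>\<^sup>+z. cmod (f z) powr p * indicator (ball c r) z \<partial>disk_area)"
proof -
  have [measurable]: "f \<in> borel_measurable disk_area"
    using holf by (rule holomorphic_measurable_disk_area)
  have [measurable]: "ball c r \<inter> space disk_area \<in> sets disk_area"
    using measurable_sets[OF id_measurable_disk_area, of "ball c r"] by simp
  have [measurable]: "(\<lambda>z. indicat_real (ball c r) z) \<in> borel_measurable disk_area"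
    by measurable
  have ball_sub: "ball c r \<subseteq> ball 0 1"
    using sub r by (meson dual_order.trans less_imp_le subset_ball)
  have lborel_le: "ennreal (1 / pi) * (\<integral>\<^sup>+z. norm (indicator (ball c r) z *\<^sub>R f z) \<partial>lborel)
      \<le> (\<integral>\<^sup>+z. cmod (f z) * indicator (ball c r) z \<partial>disk_area)"
    by (subst nn_integral_disk_area)
       (use ball_sub in \<open>auto intro!: mult_left_mono nn_integral_mono simp: indicator_def\<close>)
  have "(\<integral>\<^sup>+z. indicat_real (ball c r) z \<partial>disk_area)
      \<le> (\<integral>\<^sup>+z. indicator {z \<in> space disk_area. cmod (c - z) \<le> r} z \<partial>disk_area)"
    by (intro nn_integral_mono) (auto simp: indicator_def dist_norm)
  also have "\<dots> = emeasure disk_area {z \<in> space disk_area. cmod (c - z) \<le> r}"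
    by (rule nn_integral_indicator) measurable
  also have "\<dots> \<le> ennreal (r\<^sup>2)"
    using r by (intro emeasure_disk_area_cball_le) simp
  finally have H: "(\<integral>\<^sup>+z. indicat_real (ball c r) z \<partial>disk_area) \<le> ennreal (r\<^sup>2)" .
  have "ennreal (cmod (f c) * r\<^sup>2) = ennreal (1 / pi) * ennreal (norm (of_real (pi * r\<^sup>2) * f c))"
    by (simp add: ennreal_mult[symmetric] norm_mult norm_power)
  also have "of_real (pi * r\<^sup>2) * f c = (\<integral>z. indicator (ball c r) z *\<^sub>R f z \<partial>lborel)"
    using area_mean_value[OF holomorphic_on_subset[OF holf sub] r] by simp
  also have "ennreal (1 / pi) * ennreal (norm \<dots>)
      \<le> ennreal (1 / pi) * (\<integral>\<^sup>+z. norm (indicator (ball c r) z *\<^sub>R f z) \<partial>lborel)"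
    by (intro mult_left_mono norm_integral_le_nn_integral) auto
  also note lborel_le
  finally have A: "ennreal (cmod (f c) * r\<^sup>2) \<le> (\<integral>\<^sup>+z. cmod (f z) * indicator (ball c r) z \<partial>disk_area)" .
  have "ennreal ((cmod (f c) * r\<^sup>2) powr p)
      \<le> ennreal ((r\<^sup>2) powr (p - 1)) * (\<integral>\<^sup>+z. cmod (f z) powr p * indicator (ball c r) z \<partial>disk_area)"
    using r by (intro powr_weighted_integral_le p H A) auto
  also have "(cmod (f c) * r\<^sup>2) powr p = (r\<^sup>2) powr (p - 1) * (cmod (f c) powr p * r\<^sup>2)"
    using r by (simp add: powr_mult powr_diff)
  finally show ?thesis
    using r by (simp add: ennreal_mult ennreal_mult_le_mult_iff)
qed

lemma taylor_coeff_eq: "taylor_coeff f k = (deriv ^^ k) f 0 / fact k"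
  by (simp add: taylor_coeff_def fps_expansion_def)

lemma taylor_coeff_sums:
  assumes "f holomorphic_on ball 0 R" "z \<in> ball 0 R"
  shows "(\<lambda>n. taylor_coeff f n * z ^ n) sums f z"
  using holomorphic_power_series[OF assms] by (simp add: taylor_coeff_eq)

text \<open>With \<open>\<delta> = 1 / (4 * (k + 1))\<close>, the annulus \<open>1 - \<delta> \<le> cmod z < 1 - \<delta> / 2\<close> has area of
order \<open>\<delta>\<close>, and on it \<open>cmod z ^ (2 * k)\<close> stays above \<open>1 / 2\<close> by Bernoulli's inequality.\<close>

lemma integral_cmod_power_ball_ge:
  defines "\<delta> \<equiv> \<lambda>k. 1 / (4 * (real k + 1))"
  shows "pi * \<delta> k / 4 \<le> (\<integral>z. indicator (ball 0 (1 - \<delta> k / 2)) z *\<^sub>R cmod z ^ (2 * k) \<partial>lborel)"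
proof -
  define d where "d = \<delta> k"
  have d: "0 < d" "d \<le> 1 / 4" "real (2 * k) * d \<le> 1 / 2"
    by (auto simp: d_def \<delta>_def field_simps)
  define A :: "complex set" where "A = ball 0 (1 - d / 2) - ball 0 (1 - d)"
  have fin: "emeasure lborel (ball (0 :: complex) r) \<noteq> \<infinity>" for r
    using emeasure_lborel_ball_finite[of "0 :: complex" r] by simp
  have "measure lborel A = measure lborel (ball (0 :: complex) (1 - d / 2)) - measure lborel (ball (0 :: complex) (1 - d))"
    unfolding A_def using d fin by (intro measure_Diff) auto
  also have "\<dots> = pi * ((1 - d / 2)\<^sup>2 - (1 - d)\<^sup>2)"
    using d by (simp add: measure_lborel_complex_ball algebra_simps)
  also have "(1 - d / 2)\<^sup>2 - (1 - d)\<^sup>2 = d / 2 * (2 - 3 / 2 * d)"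
    by (simp add: power2_eq_square algebra_simps)
  finally have mA: "measure lborel A = pi * (d / 2 * (2 - 3 / 2 * d))" .
  have "d / 2 * 1 \<le> d / 2 * (2 - 3 / 2 * d)"
    using d by (intro mult_left_mono) auto
  then have "pi * (d / 2) \<le> measure lborel A"
    unfolding mA by simp
  then have "pi * d / 4 \<le> 1 / 2 * measure lborel A"
    by simp
  also have "\<dots> = (\<integral>z. 1 / 2 * indicator A z \<partial>lborel)"
    by simp
  also have "\<dots> \<le> (\<integral>z. indicator (ball 0 (1 - d / 2)) z *\<^sub>R cmod z ^ (2 * k) \<partial>lborel)"
  proof (rule integral_mono)
    have "emeasure lborel A \<le> emeasure lborel (ball (0 :: complex) (1 - d / 2))"
      by (rule emeasure_mono) (auto simp: A_def)
    then have "emeasure lborel A < \<infinity>"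
      using emeasure_lborel_ball_finite order_le_less_trans by blast
    then show "integrable lborel (\<lambda>z. 1 / 2 * indicat_real A z)"
      by (intro integrable_mult_right integrable_real_indicator) (auto simp: A_def)
    show "integrable lborel (\<lambda>z :: complex. indicator (ball 0 (1 - d / 2)) z *\<^sub>R cmod z ^ (2 * k))"
      by (rule integrable_indicator_ball[where B = 1]) (use d in \<open>auto intro!: power_le_one\<close>)
    fix z :: complex
    show "1 / 2 * indicat_real A z \<le> indicator (ball 0 (1 - d / 2)) z *\<^sub>R cmod z ^ (2 * k)"
    proof (cases "z \<in> A")
      case True
      then have z: "1 - d \<le> cmod z" "z \<in> ball 0 (1 - d / 2)"
        by (auto simp: A_def)
      have "1 / 2 \<le> 1 + real (2 * k) * (- d)"
        using d by simp
      also have "\<dots> \<le> (1 + - d) ^ (2 * k)"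
        using d by (intro Bernoulli_inequality) auto
      also have "\<dots> \<le> cmod z ^ (2 * k)"
        using z d by (intro power_mono) auto
      finally show ?thesis
        using True z by simp
    qed simp
  qed
  finally show ?thesis
    by (simp add: d_def)
qed

text \<open>Taylor coefficients of functions in the Bergman space with exponent 1 grow at most linearly.
Linear growth is exactly what the moments of a Carleson measure of order above 2 can absorb.\<close>

lemma taylor_coeff_le_norm:
  assumes holf: "f holomorphic_on ball 0 1"
  shows "ennreal (cmod (taylor_coeff f k)) \<le> ennreal (16 * (real k + 1)) * (\<integral>\<^sup>+z. cmod (f z) \<partial>disk_area)"
proof -
  have [measurable]: "f \<in> borel_measurable disk_area"
    using holf by (rule holomorphic_measurable_disk_area)
  define d where "d = 1 / (4 * (real k + 1))"
  have d: "0 < d" "d \<le> 1 / 4"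
    by (auto simp: d_def field_simps)
  define r where "r = 1 - d / 2"
  have r: "0 < r" "r < 1"
    using d by (auto simp: r_def)
  define J where "J = (\<integral>z. indicator (ball 0 r) z *\<^sub>R cmod z ^ (2 * k) \<partial>lborel)"
  have J: "pi * d / 4 \<le> J"
    using integral_cmod_power_ball_ge[of k] by (simp add: J_def r_def d_def)
  then have J0: "0 \<le> J"
    using d pi_gt_zero by (smt (verit) divide_nonneg_nonneg mult_nonneg_nonneg)
  have "ennreal (pi * d / 4 * cmod (taylor_coeff f k)) \<le> ennreal (norm (taylor_coeff f k * of_real J))"
    using mult_right_mono[OF J, of "cmod (taylor_coeff f k)"] J0
    by (intro ennreal_leI) (simp add: norm_mult mult_ac)
  also have "taylor_coeff f k * of_real J = (\<integral>z. indicator (ball 0 r) z *\<^sub>R (f z * cnj z ^ k) \<partial>lborel)"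
    using integral_ball_times_cnj_power[OF holf r, of k] by (simp add: taylor_coeff_eq J_def)
  also have "ennreal (norm \<dots>) \<le> (\<integral>\<^sup>+z. norm (indicator (ball 0 r) z *\<^sub>R (f z * cnj z ^ k)) \<partial>lborel)"
    by (rule norm_integral_le_nn_integral)
  also have "\<dots> \<le> (\<integral>\<^sup>+z. ennreal (cmod (f z)) * indicator (ball 0 1) z \<partial>lborel)"
  proof (intro nn_integral_mono)
    fix z :: complex
    show "ennreal (norm (indicator (ball 0 r) z *\<^sub>R (f z * cnj z ^ k))) \<le> ennreal (cmod (f z)) * indicator (ball 0 1) z"
    proof (cases "z \<in> ball 0 r")
      case True
      then have "cmod z \<le> 1"
        using r by simp
      then have "cmod (f z) * cmod z ^ k \<le> cmod (f z) * 1"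
        by (intro mult_left_mono power_le_one) auto
      with True r show ?thesis
        by (auto simp: norm_mult norm_power intro!: ennreal_leI)
    qed simp
  qed
  also have "\<dots> = ennreal pi * (\<integral>\<^sup>+z. cmod (f z) \<partial>disk_area)"
    by (subst nn_integral_disk_area)
       (auto simp: mult.assoc[symmetric] ennreal_mult[symmetric])
  finally have le: "ennreal (pi * d / 4 * cmod (taylor_coeff f k)) \<le> ennreal pi * (\<integral>\<^sup>+z. cmod (f z) \<partial>disk_area)" .
  have "ennreal (cmod (taylor_coeff f k)) = ennreal (4 / (pi * d)) * ennreal (pi * d / 4 * cmod (taylor_coeff f k))"
    using d by (simp add: ennreal_mult[symmetric])
  also have "\<dots> \<le> ennreal (4 / (pi * d)) * (ennreal pi * (\<integral>\<^sup>+z. cmod (f z) \<partial>disk_area))"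
    by (intro mult_left_mono le) auto
  also have "\<dots> = ennreal (4 / d) * (\<integral>\<^sup>+z. cmod (f z) \<partial>disk_area)"
    using d by (simp add: mult.assoc[symmetric] ennreal_mult[symmetric])
  also have "4 / d = 16 * (real k + 1)"
    by (simp add: d_def)
  finally show ?thesis .
qed

section \<open>Power kernels and measures of power growth\<close>

text \<open>The sum of the two geometric series that arise below from the dyadic shells on which \<open>\<rho>\<close> is
smaller, respectively larger, than the cut-off \<open>d\<close>.\<close>

definition kernel_const :: "real \<Rightarrow> real \<Rightarrow> real \<Rightarrow> real" where
  "kernel_const a b s = 2 powr a / (1 - 2 powr (a - s)) + 2 powr s / (1 - 2 powr (s - a - b))"

lemma ex_dyadic_scale:
  fixes y :: real
  assumes "1 \<le> y"
  obtains j :: nat where "2 ^ j \<le> y" "y < 2 ^ Suc j"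
proof -
  define j where "j = nat \<lfloor>log 2 y\<rfloor>"
  have "0 \<le> log 2 y"
    using assms by simp
  then have "real j \<le> log 2 y" "log 2 y < real (Suc j)"
    unfolding j_def by linarith+
  then have "2 powr real j \<le> y" "y < 2 powr real (Suc j)"
    using assms by (simp_all add: le_log_iff log_less_iff)
  then show ?thesis
    using that[of j] by (simp only: powr_realpow zero_less_numeral)
qed

text \<open>If the sublevel sets of \<open>\<rho>\<close> have mass of order \<open>u powr s\<close>, then \<open>\<rho>\<close> behaves under the integral
as a radial variable in dimension \<open>s\<close>: the condition \<open>a < s\<close> makes the kernel integrable where
\<open>\<rho>\<close> is small, \<open>s < a + b\<close> makes it integrable where \<open>\<rho>\<close> is large, and scaling gives the power of
\<open>d\<close>. This one estimate is used in dimension 2, for area and the distance to the point 1, and in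
dimension \<open>\<alpha> + 1\<close>, for a Carleson measure and the distance to the endpoint 1.\<close>

lemma nn_integral_power_kernel_le:
  fixes \<rho> :: "'a \<Rightarrow> real" and a b s d K :: real
  assumes [measurable]: "\<rho> \<in> borel_measurable M"
    and pos: "\<And>x. x \<in> space M \<Longrightarrow> 0 < \<rho> x" and d: "0 < d" and K: "0 \<le> K"
    and abs: "0 \<le> a" "a < s" "s < a + b"
    and growth: "\<And>u. 0 < u \<Longrightarrow> emeasure M {x \<in> space M. \<rho> x \<le> u} \<le> ennreal (K * u powr s)"
  shows "(\<integral>\<^sup>+x. \<rho> x powr (- a) * max d (\<rho> x) powr (- b) \<partial>M)
    \<le> ennreal (kernel_const a b s * K * d powr (s - a - b))"
proof -
  \<comment> \<open>bounds for the kernel on the shells \<open>d / 2 ^ Suc j < \<rho> x \<le> d / 2 ^ j\<close> and \<open>d * 2 ^ j \<le> \<rho> x < d * 2 ^ Suc j\<close>\<close>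
  define A where "A j = (d / 2 ^ Suc j) powr (- a) * d powr (- b)" for j :: nat
  define B where "B j = (d * 2 ^ j) powr (- a - b)" for j :: nat
  define S where "S u = {x \<in> space M. \<rho> x \<le> u}" for u
  have [measurable]: "S u \<in> sets M" for u
    unfolding S_def by measurable
  define T where "T j x = ennreal (A j) * indicator (S (d / 2 ^ j)) x
    + ennreal (B j) * indicator (S (d * 2 ^ Suc j)) x" for j x
  have [measurable]: "T j \<in> borel_measurable M" for j
    unfolding T_def by measurable
  have A0: "0 \<le> A j" and B0: "0 \<le> B j" for j
    by (auto simp: A_def B_def)
  have le: "ennreal (\<rho> x powr (- a) * max d (\<rho> x) powr (- b)) \<le> (\<Sum>j. T j x)" if x: "x \<in> space M" for x
  proof -
    have "\<exists>j. ennreal (\<rho> x powr (- a) * max d (\<rho> x) powr (- b)) \<le> T j x"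
    proof (cases "\<rho> x \<le> d")
      case True
      then obtain j where j: "2 ^ j \<le> d / \<rho> x" "d / \<rho> x < 2 ^ Suc j"
        using ex_dyadic_scale[of "d / \<rho> x"] pos[OF x] by auto
      have "\<rho> x \<le> d / 2 ^ j" "d / 2 ^ Suc j < \<rho> x"
        using j pos[OF x] by (auto simp: field_simps)
      then have "\<rho> x powr (- a) \<le> (d / 2 ^ Suc j) powr (- a)" "x \<in> S (d / 2 ^ j)"
        using abs d x by (auto intro!: powr_mono2' simp: S_def)
      moreover from this have "\<rho> x powr (- a) * max d (\<rho> x) powr (- b) \<le> A j"
        using True unfolding A_def by (intro mult_mono) auto
      ultimately have "ennreal (\<rho> x powr (- a) * max d (\<rho> x) powr (- b)) \<le> T j x"
        by (auto simp: T_def intro: add_increasing2 ennreal_leI)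
      then show ?thesis ..
    next
      case False
      then obtain j where j: "2 ^ j \<le> \<rho> x / d" "\<rho> x / d < 2 ^ Suc j"
        using ex_dyadic_scale[of "\<rho> x / d"] d by auto
      then have "d * 2 ^ j \<le> \<rho> x" "x \<in> S (d * 2 ^ Suc j)"
        using d x by (auto simp: field_simps S_def)
      moreover from this have "\<rho> x powr (- a - b) \<le> B j"
        using abs d unfolding B_def by (intro powr_mono2') auto
      then have "\<rho> x powr (- a) * max d (\<rho> x) powr (- b) \<le> B j"
        using False by (simp add: max_def powr_add[symmetric])
      ultimately have "ennreal (\<rho> x powr (- a) * max d (\<rho> x) powr (- b)) \<le> T j x"
        by (auto simp: T_def intro: add_increasing ennreal_leI)
      then show ?thesis ..
    qed
    then obtain j where "ennreal (\<rho> x powr (- a) * max d (\<rho> x) powr (- b)) \<le> T j x" ..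
    also have "T j x \<le> (\<Sum>j. T j x)"
      using sum_le_suminf[of "\<lambda>j. T j x" "{j}"] by simp
    finally show ?thesis .
  qed
  define D where "D = K * d powr (s - a - b)"
  have intT: "integral\<^sup>N M (T j) \<le> ennreal (D * 2 powr a * (2 powr (a - s)) ^ j + D * 2 powr s * (2 powr (s - a - b)) ^ j)" for j
  proof -
    have "integral\<^sup>N M (T j) = ennreal (A j) * emeasure M (S (d / 2 ^ j))
        + ennreal (B j) * emeasure M (S (d * 2 ^ Suc j))"
      unfolding T_def by (simp add: nn_integral_add nn_integral_cmult)
    also have "\<dots> \<le> ennreal (A j) * ennreal (K * (d / 2 ^ j) powr s)
        + ennreal (B j) * ennreal (K * (d * 2 ^ Suc j) powr s)"
      unfolding S_def using d by (intro add_mono mult_left_mono growth) auto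
    also have "\<dots> = ennreal (A j * (K * (d / 2 ^ j) powr s) + B j * (K * (d * 2 ^ Suc j) powr s))"
      using A0 B0 K by (simp add: ennreal_mult ennreal_plus)
    also have "A j * (K * (d / 2 ^ j) powr s) = D * 2 powr a * (2 powr (a - s)) ^ j"
    proof -
      have "A j = d powr (- a) * 2 powr (real (Suc j) * a) * d powr (- b)"
        using d unfolding A_def
        by (simp only: powr_realpow[symmetric] zero_less_numeral powr_divide powr_powr)
           (simp add: powr_minus divide_simps)
      moreover have "(d / 2 ^ j) powr s = d powr s * 2 powr (- (real j * s))"
        using d by (simp only: powr_realpow[symmetric] zero_less_numeral powr_divide powr_powr)
          (simp add: powr_minus divide_simps)
      moreover have "d powr (s - a - b) = d powr (- a) * d powr (- b) * d powr s"
        by (simp add: powr_add[symmetric] algebra_simps)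
      moreover have "(2 powr (a - s)) ^ j * 2 powr a = 2 powr (real (Suc j) * a) * 2 powr (- (real j * s))"
        by (simp add: powr_power powr_add[symmetric] algebra_simps)
      ultimately show ?thesis
        by (simp add: D_def mult_ac)
    qed
    also have "B j * (K * (d * 2 ^ Suc j) powr s) = D * 2 powr s * (2 powr (s - a - b)) ^ j"
    proof -
      have "B j = d powr (- a - b) * 2 powr (real j * (- a - b))"
        using d unfolding B_def
        by (simp only: powr_realpow[symmetric] zero_less_numeral) (simp add: powr_mult powr_powr)
      moreover have "(d * 2 ^ Suc j) powr s = d powr s * 2 powr (real (Suc j) * s)"
        using d by (simp only: powr_realpow[symmetric] zero_less_numeral) (simp add: powr_mult powr_powr)
      moreover have "d powr (s - a - b) = d powr (- a - b) * d powr s"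
        by (simp add: powr_add[symmetric] algebra_simps)
      moreover have "(2 powr (s - a - b)) ^ j * 2 powr s = 2 powr (real j * (- a - b)) * 2 powr (real (Suc j) * s)"
        by (simp add: powr_power powr_add[symmetric] algebra_simps)
      ultimately show ?thesis
        by (simp add: D_def mult_ac)
    qed
    finally show ?thesis .
  qed
  have "(\<lambda>j. D * 2 powr a * (2 powr (a - s)) ^ j + D * 2 powr s * (2 powr (s - a - b)) ^ j)
      sums (D * 2 powr a * (1 / (1 - 2 powr (a - s))) + D * 2 powr s * (1 / (1 - 2 powr (s - a - b))))"
    using abs by (intro sums_add sums_mult geometric_sums) (auto simp: powr_less_one)
  moreover have "0 \<le> D"
    using K by (simp add: D_def)
  ultimately have suminf: "(\<Sum>j. ennreal (D * 2 powr a * (2 powr (a - s)) ^ j + D * 2 powr s * (2 powr (s - a - b)) ^ j))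
      = ennreal (kernel_const a b s * K * d powr (s - a - b))"
    by (subst suminf_ennreal_eq) (simp, assumption, simp add: kernel_const_def D_def algebra_simps)
  have "(\<integral>\<^sup>+x. \<rho> x powr (- a) * max d (\<rho> x) powr (- b) \<partial>M) \<le> (\<integral>\<^sup>+x. (\<Sum>j. T j x) \<partial>M)"
    by (intro nn_integral_mono le)
  also have "\<dots> = (\<Sum>j. integral\<^sup>N M (T j))"
    by (rule nn_integral_suminf) measurable
  also have "\<dots> \<le> (\<Sum>j. ennreal (D * 2 powr a * (2 powr (a - s)) ^ j + D * 2 powr s * (2 powr (s - a - b)) ^ j))"
    by (intro suminf_le intT) auto
  finally show ?thesis
    unfolding suminf .
qed

section \<open>Measures on the unit interval\<close>

lemma space_borel_measure_on_01: "borel_measure_on_01 \<mu> \<Longrightarrow> space \<mu> = {0..<1}"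
  unfolding borel_measure_on_01_def
  by (drule sets_eq_imp_space_eq) (simp add: space_restrict_space)

lemma continuous_on_measurable_01:
  fixes f :: "real \<Rightarrow> 'b :: topological_space"
  assumes "borel_measure_on_01 \<mu>" "continuous_on {0..<1} f"
  shows "f \<in> measurable \<mu> borel"
proof -
  have "measurable \<mu> borel = measurable (restrict_space borel {0..<1}) (borel :: 'b measure)"
    using assms by (intro measurable_cong_sets) (auto simp: borel_measure_on_01_def)
  then show ?thesis
    using borel_measurable_continuous_on_restrict[OF assms(2)] by simp
qed

lemma carleson_measure_finite:
  assumes "borel_measure_on_01 \<mu>" "carleson_measure s \<mu>"
  shows "finite_measure \<mu>"
proof
  obtain M where "emeasure \<mu> {0..<1} \<le> ennreal (M * (1 - 0) powr s)"
    using assms(2) unfolding carleson_measure_def by force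
  then show "emeasure \<mu> (space \<mu>) \<noteq> \<infinity>"
    using assms(1) by (auto simp: space_borel_measure_on_01 top_unique)
qed

lemma carleson_measure_growth:
  assumes "borel_measure_on_01 \<mu>" and M: "0 < M" "0 \<le> s"
    and carleson: "\<forall>t\<in>{0..<1}. emeasure \<mu> {t..<1} \<le> ennreal (M * (1 - t) powr s)"
    and u: "0 < u"
  shows "emeasure \<mu> {t \<in> space \<mu>. 1 - t \<le> u} \<le> ennreal (M * u powr s)"
proof (cases "u \<le> 1")
  case True
  then have "{t \<in> space \<mu>. 1 - t \<le> u} = {1 - u..<1}"
    using u assms(1) by (auto simp: space_borel_measure_on_01)
  moreover have "1 - u \<in> {0..<1}"
    using u True by auto
  ultimately show ?thesis
    using carleson by (metis diff_diff_eq2 add_diff_cancel_left')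
next
  case False
  then have "{t \<in> space \<mu>. 1 - t \<le> u} = {0..<1}"
    using u assms(1) by (auto simp: space_borel_measure_on_01)
  then have "emeasure \<mu> {t \<in> space \<mu>. 1 - t \<le> u} \<le> ennreal (M * (1 - 0) powr s)"
    using carleson by force
  also have "\<dots> \<le> ennreal (M * u powr s)"
    using M False by (intro ennreal_leI mult_left_mono) (auto intro: ge_one_powr_ge_zero)
  finally show ?thesis .
qed

section \<open>The integral representation of the Hilbert operator\<close>

lemma summable_norm_taylor_coeff:
  assumes "f holomorphic_on ball 0 R" "z \<in> ball 0 R"
  shows "summable (\<lambda>k. norm (taylor_coeff f k * z ^ k))"
proof -
  obtain s where s: "cmod z < s" "s < R"
    using assms(2) dense by auto
  have "0 \<le> s"
    using s norm_ge_zero[of z] by linarith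
  then have "summable (\<lambda>k. taylor_coeff f k * of_real s ^ k)"
    using taylor_coeff_sums[OF assms(1), of "of_real s"] s by (simp add: sums_iff)
  then show ?thesis
    using s \<open>0 \<le> s\<close> by (intro powser_insidea[of _ "of_real s"]) auto
qed

text \<open>The binomial coefficients of \<open>(1 - w) powr (- (\<alpha> + 1))\<close>, in the form in which they occur in the
definition of the operator.\<close>

definition hilbert_weight :: "real \<Rightarrow> nat \<Rightarrow> real" where
  "hilbert_weight \<alpha> n = Gamma (real n + 1 + \<alpha>) / (Gamma (real n + 1) * Gamma (\<alpha> + 1))"

lemma hilbert_weight_eq:
  assumes "-1 < \<alpha>"
  shows "hilbert_weight \<alpha> n = pochhammer (\<alpha> + 1) n / fact n"
proof -
  have "\<alpha> + 1 \<notin> \<int>\<^sub>\<le>\<^sub>0"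
    using assms by (auto elim!: nonpos_Ints_cases)
  then have "pochhammer (\<alpha> + 1) n = Gamma (\<alpha> + 1 + real n) / Gamma (\<alpha> + 1)"
    by (rule pochhammer_Gamma)
  moreover have "Gamma (real n + 1) = fact n"
    using Gamma_fact[of n, where 'a = real] by (simp add: add.commute)
  ultimately show ?thesis
    by (simp add: hilbert_weight_def add_ac)
qed

lemma hilbert_weight_sums:
  assumes "-1 < \<alpha>" "cmod w < 1"
  shows "(\<lambda>n. of_real (hilbert_weight \<alpha> n) * w ^ n) sums (1 - w) powr of_real (- (\<alpha> + 1))"
proof -
  have "(of_real (- (\<alpha> + 1)) gchoose n) * (- w) ^ n = of_real (hilbert_weight \<alpha> n) * w ^ n" for n
  proof -
    have "pochhammer (of_real (\<alpha> + 1)) n = (of_real (pochhammer (\<alpha> + 1) n) :: complex)"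
      by (rule pochhammer_of_real)
    then have "(of_real (- (\<alpha> + 1)) gchoose n) = (-1) ^ n * (of_real (hilbert_weight \<alpha> n) :: complex)"
      using assms(1) by (simp add: gbinomial_pochhammer hilbert_weight_eq add.commute)
    moreover have "(- w) ^ n = (-1) ^ n * w ^ n"
      by (rule power_minus)
    moreover have "(-1) ^ n * (-1) ^ n = (1 :: complex)"
      by (rule minus_one_mult_self)
    ultimately show ?thesis
      by (simp only: mult.assoc mult.left_commute mult_1_left)
        (simp only: mult.assoc[symmetric] mult_1_left)
  qed
  then show ?thesis
    using gen_binomial_complex[of "- w" "of_real (- (\<alpha> + 1))"] assms(2) by simp
qed

lemma summable_hilbert_weight:
  assumes "-1 < \<alpha>" "cmod w < 1"
  shows "summable (\<lambda>n. norm (of_real (hilbert_weight \<alpha> n) * w ^ n))"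
proof -
  obtain s where s: "cmod w < s" "s < 1"
    using assms(2) dense by auto
  have "0 \<le> s"
    using s norm_ge_zero[of w] by linarith
  then have "summable (\<lambda>n. of_real (hilbert_weight \<alpha> n) * (of_real s :: complex) ^ n)"
    using hilbert_weight_sums[OF assms(1), of "of_real s"] s by (simp add: sums_iff)
  then show ?thesis
    using s \<open>0 \<le> s\<close> by (intro powser_insidea[of _ "of_real s"]) auto
qed

text \<open>Replacing the moments by their integrals and summing first over \<open>k\<close> and then over \<open>n\<close> turns the
double series into an integral of \<open>f\<close> against the kernel \<open>(1 - t * z) powr (- (\<alpha> + 1))\<close>. The
absolute summability of \<open>moment \<mu> k * taylor_coeff f k\<close> justifies both interchanges; it holds for
the test functions because their coefficients decay geometrically, and for a general \<open>f\<close> because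
the moments decay fast enough when \<open>\<mu>\<close> is a Carleson measure of order above 2.\<close>

lemma hilbert_op_integral_representation:
  assumes \<mu>: "borel_measure_on_01 \<mu>" "finite_measure \<mu>" and \<alpha>: "-1 < \<alpha>"
    and holf: "f holomorphic_on ball 0 1"
    and summ: "summable (\<lambda>k. moment \<mu> k * cmod (taylor_coeff f k))"
  shows "hilbert_op_defined \<mu> \<alpha> f"
    and "\<And>z. z \<in> ball 0 1 \<Longrightarrow> hilbert_op \<mu> \<alpha> f z
      = (\<integral>t. f (of_real t) * (1 - of_real t * z) powr of_real (- (\<alpha> + 1)) \<partial>\<mu>)"
proof -
  interpret finite_measure \<mu> by fact
  note space = space_borel_measure_on_01[OF \<mu>(1)]
  have int_power: "integrable \<mu> (\<lambda>t. t ^ n)" for n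
    by (rule integrable_const_bound[where B = 1])
       (auto simp: space power_le_one intro!: AE_I2 continuous_on_measurable_01[OF \<mu>(1)] continuous_intros)
  have moment_mono: "moment \<mu> (n + k) \<le> moment \<mu> k" for n k
    unfolding moment_def
    by (intro integral_mono int_power) (auto simp: space intro!: power_decreasing)
  have moment_nonneg: "0 \<le> moment \<mu> n" for n
    unfolding moment_def by (intro integral_nonneg_AE AE_I2) (auto simp: space)
  have summ_n: "summable (\<lambda>k. moment \<mu> (n + k) * cmod (taylor_coeff f k))" for n
    by (rule summable_comparison_test'[OF summ])
       (auto simp: moment_nonneg intro!: mult_right_mono moment_mono)

  \<comment> \<open>first interchange: the sum over \<open>k\<close> inside the integral gives \<open>t ^ n * f t\<close>\<close>
  define F where "F n k t = of_real (t ^ (n + k)) * taylor_coeff f k" for n k and t :: real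
  have F_int: "integrable \<mu> (F n k)" for n k
    unfolding F_def by (intro integrable_mult_left integrable_of_real int_power)
  have F_norm: "(\<integral>t. norm (F n k t) \<partial>\<mu>) = moment \<mu> (n + k) * cmod (taylor_coeff f k)" for n k
  proof -
    have "(\<integral>t. norm (F n k t) \<partial>\<mu>) = (\<integral>t. t ^ (n + k) * cmod (taylor_coeff f k) \<partial>\<mu>)"
      by (intro Bochner_Integration.integral_cong) (auto simp: F_def norm_mult norm_power space)
    then show ?thesis
      by (simp add: moment_def)
  qed
  have F_eq: "F n k t = of_real t ^ n * (taylor_coeff f k * of_real t ^ k)" for n k t
    by (simp add: F_def power_add)
  have F_summ: "summable (\<lambda>k. norm (F n k t))" if "t \<in> space \<mu>" for n t
    unfolding F_eq norm_mult[of "of_real t ^ n"]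
    using that by (intro summable_mult summable_norm_taylor_coeff[OF holf]) (auto simp: space)
  have F_sum: "(\<Sum>k. F n k t) = of_real t ^ n * f (of_real t)" if "t \<in> space \<mu>" for n t
  proof -
    have "(\<lambda>k. F n k t) sums (of_real t ^ n * f (of_real t))"
      unfolding F_eq using that by (intro sums_mult taylor_coeff_sums[OF holf]) (auto simp: space)
    then show ?thesis
      by (simp add: sums_iff)
  qed
  have F_integral: "(\<integral>t. of_real t ^ n * f (of_real t) \<partial>\<mu>) = (\<Sum>k. of_real (moment \<mu> (n + k)) * taylor_coeff f k)" for n
  proof -
    have "(\<integral>t. of_real t ^ n * f (of_real t) \<partial>\<mu>) = (\<integral>t. (\<Sum>k. F n k t) \<partial>\<mu>)"
      by (intro Bochner_Integration.integral_cong) (simp_all add: F_sum)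
    also have "\<dots> = (\<Sum>k. \<integral>t. F n k t \<partial>\<mu>)"
      by (rule integral_suminf[OF F_int]) (auto simp: F_norm summ_n intro!: AE_I2 F_summ)
    also have "(\<lambda>k. \<integral>t. F n k t \<partial>\<mu>) = (\<lambda>k. of_real (moment \<mu> (n + k)) * taylor_coeff f k)"
      unfolding F_def moment_def
      by (subst integral_mult_left_zero) (simp only: integral_complex_of_real)
    finally show ?thesis .
  qed
  have f_int: "integrable \<mu> (\<lambda>t. f (of_real t))"
  proof -
    have "integrable \<mu> (\<lambda>t. \<Sum>k. F 0 k t)"
      by (rule integrable_suminf[OF F_int]) (use F_norm summ F_summ in \<open>auto intro!: AE_I2\<close>)
    also have "?this \<longleftrightarrow> ?thesis"
      by (intro Bochner_Integration.integrable_cong) (simp_all add: F_sum)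
    finally show ?thesis .
  qed
  have coeff: "hilbert_coeff \<mu> \<alpha> f n = of_real (hilbert_weight \<alpha> n) * (\<integral>t. of_real t ^ n * f (of_real t) \<partial>\<mu>)" for n
    by (simp add: hilbert_coeff_def hilbert_weight_def F_integral)

  have main: "(\<lambda>n. hilbert_coeff \<mu> \<alpha> f n * z ^ n) sums
      (\<integral>t. f (of_real t) * (1 - of_real t * z) powr of_real (- (\<alpha> + 1)) \<partial>\<mu>)" if z: "z \<in> ball 0 1" for z
  proof -
    \<comment> \<open>second interchange: the sum over \<open>n\<close> inside the integral gives the binomial series\<close>
    define G where "G n t = (of_real (hilbert_weight \<alpha> n) * z ^ n) * (of_real t ^ n * f (of_real t))" for n and t :: real
    have cont: "continuous_on {0..<1} (\<lambda>t. f (of_real t))"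
      by (rule continuous_on_compose2[OF holomorphic_on_imp_continuous_on[OF holf]])
         (auto intro!: continuous_intros)
    have G_bound: "norm (G n t) \<le> norm (of_real (hilbert_weight \<alpha> n) * z ^ n) * norm (f (of_real t))"
      if "t \<in> space \<mu>" for n t
    proof -
      have "norm (of_real t ^ n * f (of_real t)) \<le> 1 * norm (f (of_real t))"
        using that unfolding norm_mult
        by (intro mult_right_mono) (auto simp: space norm_power power_le_one)
      then show ?thesis
        unfolding G_def norm_mult[of "_ * z ^ n"] by (intro mult_left_mono) auto
    qed
    have G_meas: "G n \<in> borel_measurable \<mu>" for n
      unfolding G_def by (rule continuous_on_measurable_01[OF \<mu>(1)]) (intro continuous_intros cont)
    have G_int: "integrable \<mu> (G n)" for n
    proof (rule Bochner_Integration.integrable_bound[OF _ G_meas])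
      show "integrable \<mu> (\<lambda>t. norm (of_real (hilbert_weight \<alpha> n) * z ^ n) * norm (f (of_real t)))"
        by (intro integrable_mult_right integrable_norm f_int)
      show "AE t in \<mu>. norm (G n t) \<le> norm (norm (of_real (hilbert_weight \<alpha> n) * z ^ n) * norm (f (of_real t)))"
        by (intro AE_I2 order_trans[OF G_bound]) auto
    qed
    have w_summ: "summable (\<lambda>n. norm (of_real (hilbert_weight \<alpha> n) * z ^ n))"
      using z by (intro summable_hilbert_weight \<alpha>) auto
    have G_summ: "summable (\<lambda>n. norm (G n t))" if "t \<in> space \<mu>" for t
      by (rule summable_comparison_test'[OF summable_mult2[OF w_summ]])
         (use G_bound[OF that] in auto)
    have G_norm: "summable (\<lambda>n. \<integral>t. norm (G n t) \<partial>\<mu>)"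
    proof (rule summable_comparison_test'[OF summable_mult2[OF w_summ]])
      fix n :: nat
      have "(\<integral>t. norm (G n t) \<partial>\<mu>) \<le> (\<integral>t. norm (of_real (hilbert_weight \<alpha> n) * z ^ n) * norm (f (of_real t)) \<partial>\<mu>)"
        by (intro integral_mono integrable_norm G_int integrable_mult_right f_int G_bound)
      also have "\<dots> = norm (of_real (hilbert_weight \<alpha> n) * z ^ n) * (\<integral>t. norm (f (of_real t)) \<partial>\<mu>)"
        by (rule integral_mult_right_zero)
      finally show "norm (\<integral>t. norm (G n t) \<partial>\<mu>) \<le> norm (of_real (hilbert_weight \<alpha> n) * z ^ n) * (\<integral>t. norm (f (of_real t)) \<partial>\<mu>)"
        by (simp add: integral_nonneg_AE)
    qed
    have "(\<lambda>n. \<integral>t. G n t \<partial>\<mu>) sums (\<integral>t. (\<Sum>n. G n t) \<partial>\<mu>)"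
      by (rule sums_integral[OF G_int _ G_norm]) (intro AE_I2 G_summ)
    moreover have "(\<integral>t. G n t \<partial>\<mu>) = hilbert_coeff \<mu> \<alpha> f n * z ^ n" for n
      unfolding G_def coeff by (subst integral_mult_right_zero) (simp add: mult_ac)
    moreover have "(\<integral>t. (\<Sum>n. G n t) \<partial>\<mu>)
        = (\<integral>t. f (of_real t) * (1 - of_real t * z) powr of_real (- (\<alpha> + 1)) \<partial>\<mu>)"
    proof (intro Bochner_Integration.integral_cong refl)
      fix t assume t: "t \<in> space \<mu>"
      have "cmod (of_real t * z) \<le> 1 * cmod z"
        using t unfolding norm_mult by (intro mult_right_mono) (auto simp: space)
      then have "(\<lambda>n. of_real (hilbert_weight \<alpha> n) * (of_real t * z) ^ n) sums (1 - of_real t * z) powr of_real (- (\<alpha> + 1))"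
        using z by (intro hilbert_weight_sums \<alpha>) auto
      from sums_mult[OF this, of "f (of_real t)"]
      have "(\<lambda>n. G n t) sums (f (of_real t) * (1 - of_real t * z) powr of_real (- (\<alpha> + 1)))"
        by (simp add: G_def power_mult_distrib mult_ac)
      then show "(\<Sum>n. G n t) = f (of_real t) * (1 - of_real t * z) powr of_real (- (\<alpha> + 1))"
        by (simp add: sums_iff)
    qed
    ultimately show ?thesis
      by simp
  qed
  show "hilbert_op_defined \<mu> \<alpha> f"
    unfolding hilbert_op_defined_def
  proof (intro conjI allI ballI)
    show "summable (\<lambda>k. of_real (moment \<mu> (n + k)) * taylor_coeff f k)" for n
      by (rule summable_norm_cancel) (use summ_n[of n] moment_nonneg in \<open>simp add: norm_mult\<close>)
  qed (use main in \<open>simp add: sums_iff\<close>)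
  show "hilbert_op \<mu> \<alpha> f z = (\<integral>t. f (of_real t) * (1 - of_real t * z) powr of_real (- (\<alpha> + 1)) \<partial>\<mu>)"
    if "z \<in> ball 0 1" for z
    using main[OF that] by (simp add: hilbert_op_def sums_iff)
qed

lemma holomorphic_hilbert_op:
  assumes "hilbert_op_defined \<mu> \<alpha> f"
  shows "hilbert_op \<mu> \<alpha> f holomorphic_on ball 0 1"
proof (rule power_series_holomorphic)
  fix z :: complex assume "z \<in> ball 0 1"
  then show "(\<lambda>n. hilbert_coeff \<mu> \<alpha> f n * (z - 0) ^ n) sums hilbert_op \<mu> \<alpha> f z"
    using assms by (simp add: hilbert_op_defined_def hilbert_op_def summable_sums)
qed

section \<open>Bergman norms\<close>

lemma nn_integral_bergman_norm:
  assumes "f \<in> bergman_space p" "0 < p"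
  shows "(\<integral>\<^sup>+z. cmod (f z) powr p \<partial>disk_area) = ennreal (bergman_norm p f powr p)"
proof -
  have "(\<integral>\<^sup>+z. cmod (f z) powr p \<partial>disk_area) = ennreal (\<integral>z. cmod (f z) powr p \<partial>disk_area)"
    using assms by (intro nn_integral_eq_integral) (auto simp: bergman_space_def)
  moreover have "0 \<le> (\<integral>z. cmod (f z) powr p \<partial>disk_area)"
    by (intro integral_nonneg_AE) auto
  ultimately show ?thesis
    using assms by (simp add: bergman_norm_def powr_powr)
qed

lemma powr_base_le_cancel:
  fixes x y p :: real
  assumes "x powr p \<le> y powr p" "0 < p" "0 \<le> y"
  shows "x \<le> y"
  using assms powr_less_mono2[of p y x] by force

lemma bergman_norm_nonneg: "0 \<le> bergman_norm p f"
  by (simp add: bergman_norm_def)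

lemma bergman_spaceI:
  assumes "f holomorphic_on ball 0 1" "(\<integral>\<^sup>+z. cmod (f z) powr p \<partial>disk_area) < \<infinity>"
  shows "f \<in> bergman_space p"
proof -
  have "f \<in> borel_measurable disk_area"
    using assms(1) by (rule holomorphic_measurable_disk_area)
  then show ?thesis
    using assms by (auto simp: bergman_space_def intro!: integrableI_nonneg)
qed

lemma bergman_norm_le:
  assumes f: "f \<in> bergman_space p" and p: "0 < p" and B: "0 \<le> B"
    and le: "(\<integral>\<^sup>+z. cmod (f z) powr p \<partial>disk_area) \<le> ennreal (B powr p)"
  shows "bergman_norm p f \<le> B"
proof -
  have "bergman_norm p f powr p \<le> B powr p"
    using le by (simp add: nn_integral_bergman_norm[OF f p])
  then show ?thesis
    using p B by (rule powr_base_le_cancel)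
qed

text \<open>The subharmonicity of \<open>cmod (f z) powr p\<close> on the disk of radius \<open>(1 - t) / 2\<close> around \<open>t\<close>.\<close>

lemma bergman_space_pointwise_bound:
  assumes f: "f \<in> bergman_space p" and p: "1 \<le> p" and t: "0 \<le> t" "t < 1"
  shows "cmod (f (of_real t)) \<le> 4 powr (1 / p) * bergman_norm p f * (1 - t) powr (- 2 / p)"
proof -
  have holf: "f holomorphic_on ball 0 1"
    using f by (simp add: bergman_space_def)
  have "ennreal (cmod (f (of_real t)) powr p * ((1 - t) / 2)\<^sup>2)
      \<le> (\<integral>\<^sup>+z. cmod (f z) powr p * indicator (ball (of_real t) ((1 - t) / 2)) z \<partial>disk_area)"
    using t by (intro powr_norm_le_disk_mean[OF holf p, where R = "1 - t"])
      (auto simp: ball_subset_ball_iff dist_norm)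
  also have "\<dots> \<le> (\<integral>\<^sup>+z. cmod (f z) powr p \<partial>disk_area)"
    by (intro nn_integral_mono ennreal_leI) (auto simp: indicator_def)
  also have "\<dots> = ennreal (bergman_norm p f powr p)"
    using f p by (intro nn_integral_bergman_norm) auto
  finally have "cmod (f (of_real t)) powr p * ((1 - t) / 2)\<^sup>2 \<le> bergman_norm p f powr p"
    by simp
  then have "cmod (f (of_real t)) powr p * ((1 - t) / 2)\<^sup>2 * (4 * (1 - t) powr (- 2))
      \<le> bergman_norm p f powr p * (4 * (1 - t) powr (- 2))"
    by (rule mult_right_mono) auto
  moreover have "((1 - t) / 2)\<^sup>2 * (4 * (1 - t) powr (- 2)) = 1"
    using t by (simp add: powr_minus power_divide)
  ultimately have "cmod (f (of_real t)) powr p * 1 \<le> bergman_norm p f powr p * (4 * (1 - t) powr (- 2))"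
    by (simp only: mult.assoc)
  then have "cmod (f (of_real t)) powr p \<le> 4 * bergman_norm p f powr p * (1 - t) powr (- 2)"
    by (simp add: mult_ac)
  also have "\<dots> = (4 powr (1 / p) * bergman_norm p f * (1 - t) powr (- 2 / p)) powr p"
    using p by (simp add: powr_mult powr_powr bergman_norm_nonneg)
  finally show ?thesis
    by (rule powr_base_le_cancel) (use p bergman_norm_nonneg in auto)
qed

section \<open>The kernel of the operator as a power kernel\<close>

text \<open>The distance from \<open>t * z\<close> to 1 is comparable with the larger of \<open>1 - t\<close> and \<open>cmod (1 - z)\<close>. This
turns the kernel of the operator into a power kernel in either variable.\<close>

lemma max_le_cmod_one_minus:
  assumes "0 \<le> t" "t < 1" "z \<in> ball 0 1"
  shows "max (1 - t) (cmod (1 - z)) \<le> 2 * cmod (1 - of_real t * z)"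
proof -
  have z: "cmod z < 1"
    using assms by simp
  have "t * cmod z \<le> t * 1"
    using assms z by (intro mult_left_mono) auto
  then have 1: "1 - t \<le> cmod (1 - of_real t * z)"
    using norm_triangle_ineq2[of 1 "of_real t * z"] assms by (simp add: norm_mult)
  have 2: "cmod (1 - z) \<le> cmod (1 - of_real t * z) + cmod (of_real (1 - t) * z)"
    using norm_triangle_ineq4[of "1 - of_real t * z" "of_real (1 - t) * z"] by (simp add: algebra_simps)
  have 3: "cmod (of_real (1 - t) * z) \<le> (1 - t) * 1"
    using assms z unfolding norm_mult norm_of_real by (intro mult_mono) auto
  have "cmod (1 - z) \<le> cmod (1 - of_real t * z) + (1 - t) * 1"
    by (rule order_trans[OF 2 add_left_mono[OF 3]])
  then have "cmod (1 - z) \<le> 2 * cmod (1 - of_real t * z)"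
    using 1 by simp
  moreover have "1 - t \<le> 2 * cmod (1 - of_real t * z)"
    using 1 norm_ge_zero[of "1 - of_real t * z"] by linarith
  ultimately show ?thesis
    by simp
qed

lemma cmod_one_minus_powr_le:
  assumes "0 \<le> t" "t < 1" "z \<in> ball 0 1" "0 \<le> b"
  shows "cmod (1 - of_real t * z) powr (- b) \<le> 2 powr b * max (1 - t) (cmod (1 - z)) powr (- b)"
proof -
  have "0 < max (1 - t) (cmod (1 - z)) / 2"
    using assms by auto
  moreover have "max (1 - t) (cmod (1 - z)) / 2 \<le> cmod (1 - of_real t * z)"
    using max_le_cmod_one_minus[OF assms(1-3)] by simp
  ultimately have "cmod (1 - of_real t * z) powr (- b) \<le> (max (1 - t) (cmod (1 - z)) / 2) powr (- b)"
    using assms by (intro powr_mono2') auto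
  also have "\<dots> = 2 powr b * max (1 - t) (cmod (1 - z)) powr (- b)"
    using assms by (simp add: powr_divide powr_minus field_simps)
  finally show ?thesis .
qed

lemma nn_integral_disk_kernel_le:
  assumes t: "0 \<le> t" "t < 1" and ab: "0 \<le> a" "a < 2" "2 < a + b"
  shows "(\<integral>\<^sup>+z. cmod (1 - z) powr (- a) * cmod (1 - of_real t * z) powr (- b) \<partial>disk_area)
    \<le> ennreal (2 powr b * kernel_const a b 2 * (1 - t) powr (2 - a - b))"
proof -
  have "(\<integral>\<^sup>+z. cmod (1 - z) powr (- a) * cmod (1 - of_real t * z) powr (- b) \<partial>disk_area)
      \<le> (\<integral>\<^sup>+z. ennreal (2 powr b) * ennreal (cmod (1 - z) powr (- a) * max (1 - t) (cmod (1 - z)) powr (- b)) \<partial>disk_area)"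
  proof (intro nn_integral_mono)
    fix z assume "z \<in> space disk_area"
    then have "cmod (1 - z) powr (- a) * cmod (1 - of_real t * z) powr (- b)
        \<le> cmod (1 - z) powr (- a) * (2 powr b * max (1 - t) (cmod (1 - z)) powr (- b))"
      using t ab by (intro mult_left_mono cmod_one_minus_powr_le) auto
    then show "ennreal (cmod (1 - z) powr (- a) * cmod (1 - of_real t * z) powr (- b))
        \<le> ennreal (2 powr b) * ennreal (cmod (1 - z) powr (- a) * max (1 - t) (cmod (1 - z)) powr (- b))"
      by (simp add: ennreal_mult[symmetric] mult_ac ennreal_leI)
  qed
  also have "\<dots> = ennreal (2 powr b) * (\<integral>\<^sup>+z. cmod (1 - z) powr (- a) * max (1 - t) (cmod (1 - z)) powr (- b) \<partial>disk_area)"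
    by (rule nn_integral_cmult) measurable
  also have "\<dots> \<le> ennreal (2 powr b) * ennreal (kernel_const a b 2 * 1 * (1 - t) powr (2 - a - b))"
  proof (intro mult_left_mono nn_integral_power_kernel_le)
    fix z assume "z \<in> space disk_area"
    then show "0 < cmod (1 - z)"
      by auto
  next
    fix u :: real assume "0 < u"
    then show "emeasure disk_area {z \<in> space disk_area. cmod (1 - z) \<le> u} \<le> ennreal (1 * u powr 2)"
      using emeasure_disk_area_cball_le[of u 1] by simp
  qed (use t ab in auto)
  also have "\<dots> = ennreal (2 powr b * kernel_const a b 2 * (1 - t) powr (2 - a - b))"
    by (simp add: ennreal_mult'[symmetric] mult.assoc)
  finally show ?thesis .
qed

lemma kernel_const_pos:
  assumes "a < s" "s < a + b"
  shows "0 < kernel_const a b s"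
proof -
  have "2 powr (a - s) < 1" "2 powr (s - a - b) < 1"
    using assms by (auto simp: powr_less_one)
  then show ?thesis
    by (auto simp: kernel_const_def intro!: add_pos_pos divide_pos_pos)
qed

section \<open>Boundedness forces the Carleson condition\<close>

text \<open>The exponent 3 is an integer, which keeps the function rational, and satisfies \<open>3 * p > 2\<close>, so that
the mass of \<open>cmod (test_function b z) powr p\<close> concentrates at distance \<open>1 - b\<close> from the point 1.\<close>

definition test_function :: "real \<Rightarrow> complex \<Rightarrow> complex" where
  "test_function b z = 1 / (1 - of_real b * z) ^ 3"

lemma test_function_holomorphic:
  assumes "0 \<le> b" "b * R \<le> 1"
  shows "test_function b holomorphic_on ball 0 R"
proof -
  have "1 - of_real b * z \<noteq> 0" if "z \<in> ball 0 R" for z :: complex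
  proof
    assume *: "1 - of_real b * z = 0"
    then have "cmod (of_real b * z) = 1"
      by simp
    then have "b * cmod z = 1"
      using assms by (simp add: norm_mult)
    moreover have "b > 0"
      using * assms by (cases "b = 0") auto
    then have "b * cmod z < b * R"
      using that by simp
    ultimately show False
      using assms by simp
  qed
  then show ?thesis
    unfolding test_function_def by (intro holomorphic_intros) auto
qed

lemma test_function_norm:
  assumes p: "1 \<le> p" and b: "0 \<le> b" "b < 1"
  defines "B \<equiv> (8 powr p * kernel_const 0 (3 * p) 2) powr (1 / p)"
  shows "test_function b \<in> bergman_space p"
    and "bergman_norm p (test_function b) \<le> B * (1 - b) powr (2 / p - 3)"
proof -
  have K: "0 < kernel_const 0 (3 * p) 2"
    using p by (intro kernel_const_pos) auto
  have hol: "test_function b holomorphic_on ball 0 1"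
    using b by (intro test_function_holomorphic) auto
  have "(\<integral>\<^sup>+z. cmod (test_function b z) powr p \<partial>disk_area)
      = (\<integral>\<^sup>+z. cmod (1 - z) powr (- 0) * cmod (1 - of_real b * z) powr (- (3 * p)) \<partial>disk_area)"
  proof (intro nn_integral_cong)
    fix z assume z: "z \<in> space disk_area"
    then have "0 < cmod (1 - of_real b * z)"
      using max_le_cmod_one_minus[of b z] b by auto
    moreover have "cmod (1 - z) \<noteq> 0"
      using z by auto
    moreover have "cmod (test_function b z) = cmod (1 - of_real b * z) powr (- 3)"
      using calculation by (simp add: test_function_def norm_divide norm_inverse norm_power powr_minus divide_inverse)
    ultimately show "ennreal (cmod (test_function b z) powr p)
        = ennreal (cmod (1 - z) powr (- 0) * cmod (1 - of_real b * z) powr (- (3 * p)))"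
      by (simp add: powr_powr)
  qed
  also have "\<dots> \<le> ennreal (2 powr (3 * p) * kernel_const 0 (3 * p) 2 * (1 - b) powr (2 - 0 - 3 * p))"
    using p b by (intro nn_integral_disk_kernel_le) auto
  also have "2 powr (3 * p) * kernel_const 0 (3 * p) 2 * (1 - b) powr (2 - 0 - 3 * p)
      = (B * (1 - b) powr (2 / p - 3)) powr p"
  proof -
    have "2 powr (3 * p) = (2 powr 3 :: real) powr p"
      by (simp only: powr_powr)
    also have "2 powr 3 = (8 :: real)"
      by simp
    finally have "2 powr (3 * p) = (8 :: real) powr p" .
    moreover have "(2 / p - 3) * p = 2 - 0 - 3 * p"
      using p by (simp add: field_simps)
    ultimately show ?thesis
      using K p by (simp add: B_def powr_mult powr_powr)
  qed
  finally have le: "(\<integral>\<^sup>+z. cmod (test_function b z) powr p \<partial>disk_area) \<le> ennreal ((B * (1 - b) powr (2 / p - 3)) powr p)" .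
  then show f: "test_function b \<in> bergman_space p"
    using hol by (intro bergman_spaceI) (auto intro: le_less_trans)
  show "bergman_norm p (test_function b) \<le> B * (1 - b) powr (2 / p - 3)"
    using p by (intro bergman_norm_le[OF f _ _ le]) (auto simp: B_def)
qed

lemma summable_moment_test_function:
  assumes \<mu>: "borel_measure_on_01 \<mu>" "finite_measure \<mu>" and b: "0 \<le> b" "b < 1"
  shows "summable (\<lambda>k. moment \<mu> k * cmod (taylor_coeff (test_function b) k))"
proof (rule summable_comparison_test')
  interpret finite_measure \<mu> by fact
  \<comment> \<open>any radius strictly between 1 and the pole at \<open>1 / b\<close> gives geometric decay of the coefficients\<close>
  define R where "R = 2 / (1 + b)"
  have R: "1 < R" "b * R \<le> 1"
    using b by (auto simp: R_def field_simps)
  then have "summable (\<lambda>k. norm (taylor_coeff (test_function b) k * 1 ^ k))"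
    using b by (intro summable_norm_taylor_coeff[OF test_function_holomorphic]) auto
  then show "summable (\<lambda>k. measure \<mu> (space \<mu>) * cmod (taylor_coeff (test_function b) k))"
    by (intro summable_mult) simp
  fix k :: nat
  have "norm (moment \<mu> k) \<le> measure \<mu> (space \<mu>)"
  proof -
    have "norm (moment \<mu> k) \<le> (\<integral>t. norm (t ^ k) \<partial>\<mu>)"
      unfolding moment_def by (rule integral_norm_bound)
    also have "\<dots> \<le> (\<integral>t. 1 \<partial>\<mu>)"
      by (rule integral_mono_AE')
         (auto simp: space_borel_measure_on_01[OF \<mu>(1)] norm_power power_le_one intro!: AE_I2)
    finally show ?thesis by simp
  qed
  then show "norm (moment \<mu> k * cmod (taylor_coeff (test_function b) k))
      \<le> measure \<mu> (space \<mu>) * cmod (taylor_coeff (test_function b) k)"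
    by (simp only: real_norm_def abs_mult abs_norm_cancel) (rule mult_right_mono, auto)
qed

text \<open>At the real point \<open>b\<close> the integrand of the representation is the positive function
\<open>(1 - t * b) powr (- (\<alpha> + 4))\<close>, and \<open>1 - t * b\<close> is at most \<open>2 * (1 - b)\<close> for \<open>t \<ge> b\<close>.\<close>

lemma hilbert_op_test_function_ge:
  assumes \<mu>: "borel_measure_on_01 \<mu>" "finite_measure \<mu>" and \<alpha>: "-1 < \<alpha>" and b: "0 \<le> b" "b < 1"
  shows "measure \<mu> {b..<1} * (2 * (1 - b)) powr (- (\<alpha> + 4)) \<le> cmod (hilbert_op \<mu> \<alpha> (test_function b) (of_real b))"
proof -
  interpret finite_measure \<mu> by fact
  note space = space_borel_measure_on_01[OF \<mu>(1)]
  define g where "g t = (1 - t * b) powr (- (\<alpha> + 4))" for t :: real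
  have tb: "1 - b \<le> 1 - t * b" "1 - t * b \<le> 1" if "t \<in> {0..<1}" for t
  proof -
    have "t * b \<le> 1 * b"
      using that b by (intro mult_right_mono) auto
    then show "1 - b \<le> 1 - t * b" "1 - t * b \<le> 1"
      using that b by auto
  qed
  have "hilbert_op \<mu> \<alpha> (test_function b) (of_real b)
      = (\<integral>t. test_function b (of_real t) * (1 - of_real t * of_real b) powr of_real (- (\<alpha> + 1)) \<partial>\<mu>)"
    using b by (intro hilbert_op_integral_representation \<mu> \<alpha> test_function_holomorphic
        summable_moment_test_function) auto
  also have "\<dots> = (\<integral>t. of_real (g t) \<partial>\<mu>)"
  proof (intro Bochner_Integration.integral_cong refl)
    fix t assume "t \<in> space \<mu>"
    then have pos: "0 < 1 - t * b"
      using tb[of t] b by (auto simp: space)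
    have "test_function b (of_real t) = of_real ((1 - t * b) powr (- 3))"
      using pos by (simp add: test_function_def powr_minus inverse_eq_divide mult.commute)
    moreover have "(1 - of_real t * of_real b) powr of_real (- (\<alpha> + 1)) = (of_real ((1 - t * b) powr (- (\<alpha> + 1))) :: complex)"
      using pos powr_of_real[of "1 - t * b" "- (\<alpha> + 1)"] by simp
    moreover have "(1 - t * b) powr (- 3) * (1 - t * b) powr (- (\<alpha> + 1)) = g t"
      unfolding g_def powr_add[symmetric] by (rule arg_cong[where f = "(powr) _"]) simp
    ultimately show "test_function b (of_real t) * (1 - of_real t * of_real b) powr of_real (- (\<alpha> + 1)) = of_real (g t)"
      by (metis of_real_mult)
  qed
  also have "\<dots> = of_real (\<integral>t. g t \<partial>\<mu>)"
    by (rule integral_complex_of_real)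
  finally have eq: "hilbert_op \<mu> \<alpha> (test_function b) (of_real b) = of_real (\<integral>t. g t \<partial>\<mu>)" .
  have sets: "{b..<1} \<in> sets \<mu>"
  proof -
    have "{b..<1} = {t \<in> space \<mu>. b \<le> t}"
      using b by (auto simp: space)
    also have "\<dots> \<in> sets \<mu>"
      using continuous_on_measurable_01[OF \<mu>(1) continuous_on_id] by measurable
    finally show ?thesis .
  qed
  have "measure \<mu> {b..<1} * (2 * (1 - b)) powr (- (\<alpha> + 4)) = (\<integral>t. indicator {b..<1} t * (2 * (1 - b)) powr (- (\<alpha> + 4)) \<partial>\<mu>)"
    using sets by simp
  also have "\<dots> \<le> (\<integral>t. g t \<partial>\<mu>)"
  proof (rule integral_mono)
    show "integrable \<mu> (\<lambda>t. indicator {b..<1} t * (2 * (1 - b)) powr (- (\<alpha> + 4)))"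
      using sets by (intro integrable_mult_left integrable_real_indicator) (simp_all add: less_top[symmetric])
    show "integrable \<mu> g"
    proof (rule integrable_const_bound)
      show "AE t in \<mu>. norm (g t) \<le> (1 - b) powr (- (\<alpha> + 4))"
        using tb b \<alpha> by (intro AE_I2) (auto simp: g_def space intro!: powr_mono2')
      have "continuous_on {0..<1} g"
        unfolding g_def using tb b by (intro continuous_intros) force
      then show "g \<in> borel_measurable \<mu>"
        by (rule continuous_on_measurable_01[OF \<mu>(1)])
    qed
    fix t assume t: "t \<in> space \<mu>"
    show "indicator {b..<1} t * (2 * (1 - b)) powr (- (\<alpha> + 4)) \<le> g t"
    proof (cases "b \<le> t")
      case True
      have "b * b \<le> t * b"
        using True b by (intro mult_right_mono) auto
      moreover have "0 \<le> (1 - b)\<^sup>2"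
        by simp
      ultimately have "1 - t * b \<le> 2 * (1 - b)"
        by (simp add: power2_eq_square algebra_simps)
      then have "(2 * (1 - b)) powr (- (\<alpha> + 4)) \<le> g t"
        unfolding g_def using tb[of t] t b \<alpha> by (intro powr_mono2') (auto simp: space)
      then show ?thesis
        using True t by (simp add: space)
    qed (simp add: g_def)
  qed
  also have "\<dots> \<le> cmod (hilbert_op \<mu> \<alpha> (test_function b) (of_real b))"
    unfolding eq by simp
  finally show ?thesis .
qed

text \<open>The value at \<open>b\<close> of the image of the test function is bounded above by its Bergman norm, hence by
a multiple of \<open>(1 - b) powr (- 3)\<close>, and below by the mass of \<open>{b..<1}\<close> times
\<open>(1 - b) powr (- (\<alpha> + 4))\<close>, up to constants.\<close>

theorem carleson_measure_if_bounded:
  assumes \<mu>: "borel_measure_on_01 \<mu>" "finite_measure \<mu>" and \<alpha>: "-1 < \<alpha>" and p: "1 \<le> p"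
    and bounded: "hilbert_op_bounded_on_bergman \<mu> \<alpha> p"
  shows "carleson_measure (\<alpha> + 1) \<mu>"
proof -
  interpret finite_measure \<mu> by fact
  obtain C where C: "0 < C" "\<And>f. f \<in> bergman_space p \<Longrightarrow> bergman_norm p (hilbert_op \<mu> \<alpha> f) \<le> C * bergman_norm p f"
    using bounded by (auto simp: hilbert_op_bounded_on_bergman_def)
  define B where "B = (8 powr p * kernel_const 0 (3 * p) 2) powr (1 / p)"
  define L where "L = 4 powr (1 / p) * (C * B)"
  have "0 < kernel_const 0 (3 * p) 2"
    using p by (intro kernel_const_pos) auto
  then have "0 < B"
    unfolding B_def powr_gt_zero by (metis less_irrefl mult_pos_pos powr_gt_zero zero_neq_numeral)
  then have L: "0 < L"
    using C by (simp add: L_def)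
  have "measure \<mu> {b..<1} \<le> L * 2 powr (\<alpha> + 4) * (1 - b) powr (\<alpha> + 1)" if b: "0 \<le> b" "b < 1" for b
  proof -
    note test = test_function_norm[OF p b, folded B_def]
    have Hf: "hilbert_op \<mu> \<alpha> (test_function b) \<in> bergman_space p"
      using bounded test by (auto simp: hilbert_op_bounded_on_bergman_def)
    have "measure \<mu> {b..<1} * (2 * (1 - b)) powr (- (\<alpha> + 4)) \<le> cmod (hilbert_op \<mu> \<alpha> (test_function b) (of_real b))"
      by (rule hilbert_op_test_function_ge[OF \<mu> \<alpha> b])
    also have "\<dots> \<le> 4 powr (1 / p) * bergman_norm p (hilbert_op \<mu> \<alpha> (test_function b)) * (1 - b) powr (- 2 / p)"
      by (rule bergman_space_pointwise_bound[OF Hf p b])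
    also have "\<dots> \<le> 4 powr (1 / p) * (C * (B * (1 - b) powr (2 / p - 3))) * (1 - b) powr (- 2 / p)"
      using C(1) by (intro mult_right_mono mult_left_mono order_trans[OF C(2)] test) auto
    also have "\<dots> = L * ((1 - b) powr (2 / p - 3) * (1 - b) powr (- 2 / p))"
      by (simp add: L_def)
    also have "(1 - b) powr (2 / p - 3) * (1 - b) powr (- 2 / p) = (1 - b) powr (- 3)"
      unfolding powr_add[symmetric] by simp
    finally have "measure \<mu> {b..<1} * (2 * (1 - b)) powr (- (\<alpha> + 4)) * (2 * (1 - b)) powr (\<alpha> + 4)
        \<le> L * (1 - b) powr (- 3) * (2 * (1 - b)) powr (\<alpha> + 4)"
      by (rule mult_right_mono) auto
    also have "measure \<mu> {b..<1} * (2 * (1 - b)) powr (- (\<alpha> + 4)) * (2 * (1 - b)) powr (\<alpha> + 4) = measure \<mu> {b..<1}"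
      unfolding mult.assoc powr_add[symmetric] using b by simp
    also have "L * (1 - b) powr (- 3) * (2 * (1 - b)) powr (\<alpha> + 4)
        = L * 2 powr (\<alpha> + 4) * ((1 - b) powr (- 3) * (1 - b) powr (\<alpha> + 4))"
      using b by (simp only: powr_mult) (simp add: mult_ac)
    also have "(1 - b) powr (- 3) * (1 - b) powr (\<alpha> + 4) = (1 - b) powr (\<alpha> + 1)"
      unfolding powr_add[symmetric] by (simp add: add.commute)
    finally show ?thesis .
  qed
  then have "\<forall>b\<in>{0..<1}. emeasure \<mu> {b..<1} \<le> ennreal (L * 2 powr (\<alpha> + 4) * (1 - b) powr (\<alpha> + 1))"
    by (auto simp: emeasure_eq_measure intro!: ennreal_leI)
  moreover have "0 < L * 2 powr (\<alpha> + 4)"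
    using L by simp
  ultimately show ?thesis
    unfolding carleson_measure_def by blast
qed

section \<open>The Carleson condition implies boundedness\<close>

lemma id_measurable_01:
  "borel_measure_on_01 \<mu> \<Longrightarrow> (\<lambda>t. t) \<in> borel_measurable \<mu>"
  by (rule continuous_on_measurable_01[OF _ continuous_on_id])

lemma nn_integral_carleson_kernel_le:
  assumes \<mu>: "borel_measure_on_01 \<mu>" and M: "0 < M" and ab: "0 \<le> a" "a < s" "s < a + b" and d: "0 < d"
    and carleson: "\<forall>t\<in>{0..<1}. emeasure \<mu> {t..<1} \<le> ennreal (M * (1 - t) powr s)"
  shows "(\<integral>\<^sup>+t. (1 - t) powr (- a) * max d (1 - t) powr (- b) \<partial>\<mu>)
    \<le> ennreal (kernel_const a b s * M * d powr (s - a - b))"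
proof (rule nn_integral_power_kernel_le)
  have [measurable]: "(\<lambda>t. t) \<in> borel_measurable \<mu>"
    using \<mu> by (rule id_measurable_01)
  show "(\<lambda>t. 1 - t) \<in> borel_measurable \<mu>"
    by measurable
  show "emeasure \<mu> {t \<in> space \<mu>. 1 - t \<le> u} \<le> ennreal (M * u powr s)" if "0 < u" for u
    using ab that by (intro carleson_measure_growth[OF \<mu> M _ carleson]) auto
qed (use assms in \<open>auto simp: space_borel_measure_on_01\<close>)

text \<open>The series \<open>\<Sum>k. (k + 1) * t ^ k\<close> equals \<open>(1 - t) powr (- 2)\<close>, which is integrable because the
order of the Carleson measure exceeds 2.\<close>

lemma summable_Suc_moment:
  assumes \<mu>: "borel_measure_on_01 \<mu>" and s: "2 < s" and carleson: "carleson_measure s \<mu>"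
  shows "summable (\<lambda>k. real (Suc k) * moment \<mu> k)"
proof -
  interpret finite_measure \<mu>
    by (rule carleson_measure_finite[OF \<mu> carleson])
  note space = space_borel_measure_on_01[OF \<mu>]
  have [measurable]: "(\<lambda>t. t) \<in> borel_measurable \<mu>"
    using \<mu> by (rule id_measurable_01)
  obtain M where M: "0 < M" "\<forall>t\<in>{0..<1}. emeasure \<mu> {t..<1} \<le> ennreal (M * (1 - t) powr s)"
    using carleson by (auto simp: carleson_measure_def)
  have int: "integrable \<mu> (\<lambda>t. t ^ k)" for k
    by (rule integrable_const_bound[where B = 1])
       (auto simp: space power_le_one intro!: AE_I2)
  have nonneg: "0 \<le> moment \<mu> k" for k
    unfolding moment_def by (intro integral_nonneg_AE AE_I2) (auto simp: space)
  have moment: "ennreal (real (Suc k) * moment \<mu> k) = (\<integral>\<^sup>+t. real (Suc k) * t ^ k \<partial>\<mu>)" for k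
  proof -
    have "(\<integral>\<^sup>+t. real (Suc k) * t ^ k \<partial>\<mu>) = ennreal (\<integral>t. real (Suc k) * t ^ k \<partial>\<mu>)"
      by (intro nn_integral_eq_integral integrable_mult_right int AE_I2) (auto simp: space)
    then show ?thesis
      by (simp add: moment_def)
  qed
  have "(\<Sum>k. ennreal (real (Suc k) * moment \<mu> k)) = (\<integral>\<^sup>+t. (\<Sum>k. ennreal (real (Suc k) * t ^ k)) \<partial>\<mu>)"
    unfolding moment by (rule nn_integral_suminf[symmetric]) measurable
  also have "\<dots> = (\<integral>\<^sup>+t. (1 - t) powr (- 2) * max 1 (1 - t) powr (- s) \<partial>\<mu>)"
  proof (intro nn_integral_cong)
    fix t assume "t \<in> space \<mu>"
    then have t: "0 \<le> t" "t < 1"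
      by (auto simp: space)
    then have "(\<lambda>k. real (Suc k) * t ^ k) sums (1 / (1 - t)\<^sup>2)"
      using geometric_deriv_sums[of t] by simp
    then have "(\<Sum>k. ennreal (real (Suc k) * t ^ k)) = ennreal (1 / (1 - t)\<^sup>2)"
      using t by (intro suminf_ennreal_eq) auto
    also have "1 / (1 - t)\<^sup>2 = (1 - t) powr (- 2) * max 1 (1 - t) powr (- s)"
      using t by (simp add: powr_minus max_def divide_inverse)
    finally show "(\<Sum>k. ennreal (real (Suc k) * t ^ k)) = ennreal ((1 - t) powr (- 2) * max 1 (1 - t) powr (- s))" .
  qed
  also have "\<dots> \<le> ennreal (kernel_const 2 s s * M * 1 powr (s - 2 - s))"
    by (intro nn_integral_carleson_kernel_le \<mu> M) (use s in auto)
  finally have "(\<Sum>k. ennreal (real (Suc k) * moment \<mu> k)) \<noteq> top"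
    by (auto simp: top_unique)
  then show ?thesis
    by (intro summable_suminf_not_top) (auto intro: mult_nonneg_nonneg nonneg)
qed

lemma bergman_space_nn_integral_finite:
  assumes f: "f \<in> bergman_space p" and p: "1 \<le> p"
  shows "(\<integral>\<^sup>+z. cmod (f z) \<partial>disk_area) < \<infinity>"
proof -
  interpret finite_measure disk_area
    by (rule finite_measure_disk_area)
  have [measurable]: "f \<in> borel_measurable disk_area"
    using f by (auto simp: bergman_space_def intro: holomorphic_measurable_disk_area)
  have "cmod w \<le> 1 + cmod w powr p" for w
  proof (cases "cmod w \<le> 1")
    case False
    then have "cmod w powr 1 \<le> cmod w powr p"
      using p by (intro powr_mono) auto
    then show ?thesis
      using False by simp
  qed (simp add: add_increasing2)
  then have "(\<integral>\<^sup>+z. cmod (f z) \<partial>disk_area) \<le> (\<integral>\<^sup>+z. 1 + ennreal (cmod (f z) powr p) \<partial>disk_area)"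
    by (intro nn_integral_mono) (simp add: ennreal_leI flip: ennreal_1 ennreal_plus)
  also have "\<dots> = emeasure disk_area (space disk_area) + (\<integral>\<^sup>+z. cmod (f z) powr p \<partial>disk_area)"
    by (subst nn_integral_add) auto
  also have "\<dots> < \<infinity>"
    using nn_integral_bergman_norm[OF f] p by (simp add: less_top[symmetric])
  finally show ?thesis .
qed

lemma summable_moment_taylor_coeff:
  assumes \<mu>: "borel_measure_on_01 \<mu>" and s: "2 < s" and carleson: "carleson_measure s \<mu>"
    and f: "f \<in> bergman_space p" and p: "1 \<le> p"
  shows "summable (\<lambda>k. moment \<mu> k * cmod (taylor_coeff f k))"
proof -
  have holf: "f holomorphic_on ball 0 1"
    using f by (simp add: bergman_space_def)
  obtain N where N: "0 \<le> N" "(\<integral>\<^sup>+z. cmod (f z) \<partial>disk_area) = ennreal N"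
    using bergman_space_nn_integral_finite[OF f p] by (cases "\<integral>\<^sup>+z. cmod (f z) \<partial>disk_area") auto
  have nonneg: "0 \<le> moment \<mu> k" for k
    unfolding moment_def by (intro integral_nonneg_AE AE_I2) (auto simp: space_borel_measure_on_01[OF \<mu>])
  have coeff: "cmod (taylor_coeff f k) \<le> 16 * N * real (Suc k)" for k
  proof -
    have "ennreal (cmod (taylor_coeff f k)) \<le> ennreal (16 * (real k + 1) * N)"
      using taylor_coeff_le_norm[OF holf, of k] N by (simp add: ennreal_mult)
    then show ?thesis
      using N by (simp add: mult_ac add.commute)
  qed
  show ?thesis
  proof (rule summable_comparison_test')
    show "summable (\<lambda>k. 16 * N * (real (Suc k) * moment \<mu> k))"
      by (intro summable_mult summable_Suc_moment[OF \<mu> s carleson])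
    fix k :: nat
    have "moment \<mu> k * cmod (taylor_coeff f k) \<le> moment \<mu> k * (16 * N * real (Suc k))"
      by (intro mult_left_mono coeff nonneg)
    then show "norm (moment \<mu> k * cmod (taylor_coeff f k)) \<le> 16 * N * (real (Suc k) * moment \<mu> k)"
      using nonneg[of k] by (simp add: mult_ac)
  qed
qed

text \<open>Each value \<open>f t\<close> is dominated by a mean over the disk of radius \<open>(1 - t) / 2\<close> around \<open>t\<close>. After
exchanging the integrals, a point \<open>z\<close> only meets disks whose centre satisfies
\<open>2 / 3 * cmod (1 - z) \<le> 1 - t \<le> 2 * cmod (1 - z)\<close>, and the Carleson condition bounds the
mass of these \<open>t\<close>.\<close>

lemma carleson_embedding:
  assumes \<mu>: "borel_measure_on_01 \<mu>" and M: "0 < M" and s: "0 \<le> s"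
    and carleson: "\<forall>t\<in>{0..<1}. emeasure \<mu> {t..<1} \<le> ennreal (M * (1 - t) powr s)"
    and holf: "f holomorphic_on ball 0 1" and p: "1 \<le> p"
  shows "(\<integral>\<^sup>+t. cmod (f (of_real t)) powr p * (1 - t) powr (2 - s) \<partial>\<mu>)
    \<le> ennreal (4 * (M * 3 powr s)) * (\<integral>\<^sup>+z. cmod (f z) powr p \<partial>disk_area)"
proof -
  note space = space_borel_measure_on_01[OF \<mu>]
  have "carleson_measure s \<mu>"
    using M carleson by (auto simp: carleson_measure_def)
  then interpret mu: finite_measure \<mu>
    by (rule carleson_measure_finite[OF \<mu>])
  interpret da: finite_measure disk_area
    by (rule finite_measure_disk_area)
  interpret pair_sigma_finite disk_area \<mu> ..
  have [measurable]: "(\<lambda>t. t) \<in> borel_measurable \<mu>"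
    using \<mu> by (rule id_measurable_01)
  have f_meas [measurable]: "f \<in> borel_measurable disk_area"
    using holf by (rule holomorphic_measurable_disk_area)
  \<comment> \<open>the disk means of \<open>cmod (f z) powr p\<close> written as a joint kernel, ready for Tonelli\<close>
  define Q where "Q z t = (if cmod (of_real t - z) < (1 - t) / 2 then (1 - t) powr (- s) else 0)" for z and t :: real
  have Q_meas [measurable]: "case_prod Q \<in> borel_measurable (disk_area \<Otimes>\<^sub>M \<mu>)"
    unfolding Q_def by measurable
  have pt: "ennreal (cmod (f (of_real t)) powr p * (1 - t) powr (2 - s))
      \<le> (\<integral>\<^sup>+z. ennreal 4 * (ennreal (cmod (f z) powr p) * ennreal (Q z t)) \<partial>disk_area)" if "t \<in> space \<mu>" for t
  proof -
    have t: "0 \<le> t" "t < 1"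
      using that by (auto simp: space)
    have "(1 - t) powr (2 - s) = (1 - t) powr 2 * (1 - t) powr (- s)"
      unfolding powr_add[symmetric] by simp
    also have "\<dots> = ((1 - t) / 2)\<^sup>2 * (4 * (1 - t) powr (- s))"
      using t by (simp add: power_divide)
    finally have "ennreal (cmod (f (of_real t)) powr p * (1 - t) powr (2 - s))
        = ennreal (4 * (1 - t) powr (- s)) * ennreal (cmod (f (of_real t)) powr p * ((1 - t) / 2)\<^sup>2)"
      by (simp add: ennreal_mult[symmetric] mult_ac)
    also have "\<dots> \<le> ennreal (4 * (1 - t) powr (- s))
        * (\<integral>\<^sup>+z. cmod (f z) powr p * indicator (ball (of_real t) ((1 - t) / 2)) z \<partial>disk_area)"
      using t by (intro mult_left_mono powr_norm_le_disk_mean[OF holf p, where R = "1 - t"])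
        (auto simp: ball_subset_ball_iff dist_norm)
    also have "\<dots> = (\<integral>\<^sup>+z. ennreal (4 * (1 - t) powr (- s))
        * ennreal (cmod (f z) powr p * indicator (ball (of_real t) ((1 - t) / 2)) z) \<partial>disk_area)"
      by (rule nn_integral_cmult[symmetric]) measurable
    also have "\<dots> = (\<integral>\<^sup>+z. ennreal 4 * (ennreal (cmod (f z) powr p) * ennreal (Q z t)) \<partial>disk_area)"
      by (intro nn_integral_cong) (simp add: Q_def indicator_def dist_norm ennreal_mult mult_ac)
    finally show ?thesis .
  qed
  have Q_int: "(\<integral>\<^sup>+t. Q z t \<partial>\<mu>) \<le> ennreal (M * 3 powr s)" if z: "z \<in> space disk_area" for z
  proof -
    define x where "x = cmod (1 - z)"
    have x: "0 < x"
      using z by (auto simp: x_def)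
    define S where "S = {t \<in> space \<mu>. 1 - t \<le> 2 * x}"
    have [measurable]: "S \<in> sets \<mu>"
      unfolding S_def by measurable
    have "(\<integral>\<^sup>+t. Q z t \<partial>\<mu>) \<le> (\<integral>\<^sup>+t. ennreal ((2 / 3 * x) powr (- s)) * indicator S t \<partial>\<mu>)"
    proof (intro nn_integral_mono)
      fix t assume t: "t \<in> space \<mu>"
      show "ennreal (Q z t) \<le> ennreal ((2 / 3 * x) powr (- s)) * indicator S t"
      proof (cases "cmod (of_real t - z) < (1 - t) / 2")
        case True
        have "x \<le> cmod (1 - of_real t) + cmod (of_real t - z)"
          unfolding x_def using norm_triangle_ineq[of "1 - of_real t" "of_real t - z"] by simp
        moreover have "cmod (1 - of_real t) \<le> x + cmod (of_real t - z)"
          unfolding x_def using norm_triangle_ineq4[of "1 - z" "of_real t - z"] by simp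
        moreover have "cmod (1 - of_real t) = 1 - t"
          using t norm_of_real[of "1 - t", where 'a = complex] by (simp add: space)
        ultimately have "2 / 3 * x \<le> 1 - t" "1 - t \<le> 2 * x"
          using True by auto
        then have "(1 - t) powr (- s) \<le> (2 / 3 * x) powr (- s)" "t \<in> S"
          using x s t by (auto intro!: powr_mono2' simp: S_def)
        then show ?thesis
          using True by (simp add: Q_def ennreal_leI)
      qed (simp add: Q_def)
    qed
    also have "\<dots> = ennreal ((2 / 3 * x) powr (- s)) * emeasure \<mu> S"
      by (simp add: nn_integral_cmult_indicator)
    also have "\<dots> \<le> ennreal ((2 / 3 * x) powr (- s)) * ennreal (M * (2 * x) powr s)"
      unfolding S_def using x by (intro mult_left_mono carleson_measure_growth[OF \<mu> M s carleson]) auto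
    also have "\<dots> = ennreal ((2 / 3 * x) powr (- s) * (M * (2 * x) powr s))"
      using M by (simp add: ennreal_mult)
    also have "(2 / 3 * x) powr (- s) * (M * (2 * x) powr s) = M * 3 powr s"
    proof -
      have "(2 * x) powr s = (3 * (2 / 3 * x)) powr s"
        by simp
      also have "\<dots> = 3 powr s * (2 / 3 * x) powr s"
        using x by (intro powr_mult)
      finally show ?thesis
        using x by (simp add: powr_minus)
    qed
    finally show ?thesis .
  qed
  have "(\<integral>\<^sup>+t. cmod (f (of_real t)) powr p * (1 - t) powr (2 - s) \<partial>\<mu>)
      \<le> (\<integral>\<^sup>+t. \<integral>\<^sup>+z. ennreal 4 * (ennreal (cmod (f z) powr p) * ennreal (Q z t)) \<partial>disk_area \<partial>\<mu>)"
    by (intro nn_integral_mono pt)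
  also have "\<dots> = (\<integral>\<^sup>+z. \<integral>\<^sup>+t. ennreal 4 * (ennreal (cmod (f z) powr p) * ennreal (Q z t)) \<partial>\<mu> \<partial>disk_area)"
    by (rule Fubini') measurable
  also have "\<dots> = (\<integral>\<^sup>+z. ennreal 4 * (ennreal (cmod (f z) powr p) * (\<integral>\<^sup>+t. Q z t \<partial>\<mu>)) \<partial>disk_area)"
    by (intro nn_integral_cong) (simp add: nn_integral_cmult)
  also have "\<dots> \<le> (\<integral>\<^sup>+z. ennreal 4 * (ennreal (cmod (f z) powr p) * ennreal (M * 3 powr s)) \<partial>disk_area)"
    by (intro nn_integral_mono mult_left_mono Q_int) auto
  also have "\<dots> = (\<integral>\<^sup>+z. ennreal (4 * (M * 3 powr s)) * ennreal (cmod (f z) powr p) \<partial>disk_area)"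
    using M by (intro nn_integral_cong) (simp add: ennreal_mult mult_ac)
  also have "\<dots> = ennreal (4 * (M * 3 powr s)) * (\<integral>\<^sup>+z. cmod (f z) powr p \<partial>disk_area)"
    by (rule nn_integral_cmult) measurable
  finally show ?thesis .
qed

text \<open>The Schur test with weight \<open>1 / (1 - t)\<close>. The total weight at \<open>z\<close> is a power kernel for \<open>\<mu>\<close>
with cut-off \<open>cmod (1 - z)\<close>, hence at most \<open>C / cmod (1 - z)\<close>.\<close>

lemma hilbert_op_pointwise_bound:
  assumes \<mu>: "borel_measure_on_01 \<mu>" and \<alpha>: "0 < \<alpha>" and M: "0 < M"
    and carleson: "\<forall>t\<in>{0..<1}. emeasure \<mu> {t..<1} \<le> ennreal (M * (1 - t) powr (\<alpha> + 1))"
    and holf: "f holomorphic_on ball 0 1" and p: "1 \<le> p"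
    and summ: "summable (\<lambda>k. moment \<mu> k * cmod (taylor_coeff f k))"
    and z: "z \<in> ball 0 1"
  defines "C \<equiv> 2 powr (\<alpha> + 1) * kernel_const 1 (\<alpha> + 1) (\<alpha> + 1) * M"
  shows "ennreal (cmod (hilbert_op \<mu> \<alpha> f z) powr p) \<le> (\<integral>\<^sup>+t. C powr (p - 1) * (cmod (f (of_real t)) powr p * (1 - t) powr (p - 1)
      * (cmod (1 - z) powr (- (p - 1)) * cmod (1 - of_real t * z) powr (- (\<alpha> + 1)))) \<partial>\<mu>)"
proof -
  note space = space_borel_measure_on_01[OF \<mu>]
  have fin: "finite_measure \<mu>"
    using M carleson by (intro carleson_measure_finite[OF \<mu>, of "\<alpha> + 1"]) (auto simp: carleson_measure_def)
  have [measurable]: "(\<lambda>t. t) \<in> borel_measurable \<mu>"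
    using \<mu> by (rule id_measurable_01)
  have [measurable]: "(\<lambda>t. f (of_real t)) \<in> borel_measurable \<mu>"
    by (rule continuous_on_measurable_01[OF \<mu>])
       (rule continuous_on_compose2[OF holomorphic_on_imp_continuous_on[OF holf]], auto intro!: continuous_intros)
  define x where "x = cmod (1 - z)"
  have x: "0 < x"
    using z by (auto simp: x_def)
  \<comment> \<open>the modulus of the integrand is \<open>g t * h t\<close>, with \<open>h\<close> as the weight for Jensen's inequality\<close>
  define g where "g t = cmod (f (of_real t)) * (1 - t)" for t
  define h where "h t = (1 - t) powr (- 1) * cmod (1 - of_real t * z) powr (- (\<alpha> + 1))" for t
  have [measurable]: "g \<in> borel_measurable \<mu>" "h \<in> borel_measurable \<mu>"
    unfolding g_def h_def by measurable
  have C: "0 < C"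
    using M \<alpha> kernel_const_pos[of 1 "\<alpha> + 1" "\<alpha> + 1"] by (simp add: C_def)
  have "(\<integral>\<^sup>+t. h t \<partial>\<mu>) \<le> (\<integral>\<^sup>+t. ennreal (2 powr (\<alpha> + 1)) * ennreal ((1 - t) powr (- 1) * max x (1 - t) powr (- (\<alpha> + 1))) \<partial>\<mu>)"
  proof (intro nn_integral_mono)
    fix t assume t: "t \<in> space \<mu>"
    have "h t \<le> (1 - t) powr (- 1) * (2 powr (\<alpha> + 1) * max (1 - t) x powr (- (\<alpha> + 1)))"
      unfolding h_def x_def using t z \<alpha> by (intro mult_left_mono cmod_one_minus_powr_le) (auto simp: space)
    then show "ennreal (h t) \<le> ennreal (2 powr (\<alpha> + 1)) * ennreal ((1 - t) powr (- 1) * max x (1 - t) powr (- (\<alpha> + 1)))"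
      by (simp add: ennreal_mult[symmetric] mult_ac max.commute ennreal_leI)
  qed
  also have "\<dots> = ennreal (2 powr (\<alpha> + 1)) * (\<integral>\<^sup>+t. (1 - t) powr (- 1) * max x (1 - t) powr (- (\<alpha> + 1)) \<partial>\<mu>)"
    by (rule nn_integral_cmult) measurable
  also have "\<dots> \<le> ennreal (2 powr (\<alpha> + 1)) * ennreal (kernel_const 1 (\<alpha> + 1) (\<alpha> + 1) * M * x powr (\<alpha> + 1 - 1 - (\<alpha> + 1)))"
    by (intro mult_left_mono nn_integral_carleson_kernel_le \<mu> M x carleson) (use \<alpha> in auto)
  also have "\<dots> = ennreal (C * x powr (- 1))"
    by (simp add: C_def ennreal_mult'[symmetric] mult.assoc)
  finally have H: "(\<integral>\<^sup>+t. h t \<partial>\<mu>) \<le> ennreal (C * x powr (- 1))" .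
  have "ennreal (cmod (hilbert_op \<mu> \<alpha> f z))
      \<le> (\<integral>\<^sup>+t. norm (f (of_real t) * (1 - of_real t * z) powr of_real (- (\<alpha> + 1))) \<partial>\<mu>)"
    using hilbert_op_integral_representation(2)[OF \<mu> fin _ holf summ z, of \<alpha>] \<alpha> norm_integral_le_nn_integral
    by simp
  also have "\<dots> = (\<integral>\<^sup>+t. g t * h t \<partial>\<mu>)"
  proof (intro nn_integral_cong)
    fix t assume t: "t \<in> space \<mu>"
    have "norm ((1 - of_real t * z) powr of_real (- (\<alpha> + 1))) = cmod (1 - of_real t * z) powr (- (\<alpha> + 1))"
      by (subst norm_powr_real_powr') auto
    moreover have "(1 - t) * (1 - t) powr (- 1) = 1"
      using t by (simp add: space powr_minus)
    ultimately show "ennreal (norm (f (of_real t) * (1 - of_real t * z) powr of_real (- (\<alpha> + 1)))) = ennreal (g t * h t)"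
      by (simp add: g_def h_def norm_mult mult.assoc[of _ "1 - t"] mult.assoc[symmetric, of "1 - t" "(1 - t) powr (- 1)"])
  qed
  finally have A: "ennreal (cmod (hilbert_op \<mu> \<alpha> f z)) \<le> (\<integral>\<^sup>+t. g t * h t \<partial>\<mu>)" .
  have "ennreal (cmod (hilbert_op \<mu> \<alpha> f z) powr p) \<le> ennreal ((C * x powr (- 1)) powr (p - 1)) * (\<integral>\<^sup>+t. g t powr p * h t \<partial>\<mu>)"
    by (rule powr_weighted_integral_le[OF p _ _ _ _ _ H _ A]) (use C x in \<open>auto simp: g_def h_def space\<close>)
  also have "\<dots> = (\<integral>\<^sup>+t. ennreal ((C * x powr (- 1)) powr (p - 1)) * ennreal (g t powr p * h t) \<partial>\<mu>)"
    by (rule nn_integral_cmult[symmetric]) measurable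
  also have "\<dots> = (\<integral>\<^sup>+t. C powr (p - 1) * (cmod (f (of_real t)) powr p * (1 - t) powr (p - 1)
      * (cmod (1 - z) powr (- (p - 1)) * cmod (1 - of_real t * z) powr (- (\<alpha> + 1)))) \<partial>\<mu>)"
  proof (intro nn_integral_cong)
    fix t assume t: "t \<in> space \<mu>"
    have "(C * x powr (- 1)) powr (p - 1) = C powr (p - 1) * x powr (- (p - 1))"
      by (simp only: powr_mult powr_powr mult_minus1)
    moreover have "(1 - t) powr p * (1 - t) powr (- 1) = (1 - t) powr (p - 1)"
      unfolding powr_add[symmetric] by simp
    then have "g t powr p * h t = cmod (f (of_real t)) powr p * (1 - t) powr (p - 1) * cmod (1 - of_real t * z) powr (- (\<alpha> + 1))"
      unfolding g_def h_def powr_mult by (metis mult.assoc)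
    ultimately show "ennreal ((C * x powr (- 1)) powr (p - 1)) * ennreal (g t powr p * h t)
      = ennreal (C powr (p - 1) * (cmod (f (of_real t)) powr p * (1 - t) powr (p - 1)
      * (cmod (1 - z) powr (- (p - 1)) * cmod (1 - of_real t * z) powr (- (\<alpha> + 1)))))"
      by (simp add: ennreal_mult[symmetric] x_def mult_ac)
  qed
  finally show ?thesis .
qed

text \<open>Integrating the pointwise bound over the disk leaves, for each \<open>t\<close>, the area integral of
\<open>cmod (1 - z) powr (- (p - 1)) * cmod (1 - t * z) powr (- (\<alpha> + 1))\<close>, a power kernel in dimension
2 that converges at \<open>z = 1\<close> because \<open>p - 1 < 2\<close>. The powers of \<open>1 - t\<close> then add up to
\<open>1 - \<alpha>\<close>, the weight in the Carleson embedding of order \<open>\<alpha> + 1\<close>.\<close>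

theorem bounded_if_carleson_measure:
  assumes \<mu>: "borel_measure_on_01 \<mu>" and \<alpha>: "1 < \<alpha>" and p: "1 \<le> p" "p < 3"
    and carleson: "carleson_measure (\<alpha> + 1) \<mu>"
  shows "hilbert_op_bounded_on_bergman \<mu> \<alpha> p"
proof -
  note space = space_borel_measure_on_01[OF \<mu>]
  have fin: "finite_measure \<mu>"
    by (rule carleson_measure_finite[OF \<mu> carleson])
  interpret mu: finite_measure \<mu> by fact
  interpret da: finite_measure disk_area
    by (rule finite_measure_disk_area)
  interpret pair_sigma_finite \<mu> disk_area ..
  have [measurable]: "(\<lambda>t. t) \<in> borel_measurable \<mu>"
    using \<mu> by (rule id_measurable_01)
  obtain M where M: "0 < M" "\<forall>t\<in>{0..<1}. emeasure \<mu> {t..<1} \<le> ennreal (M * (1 - t) powr (\<alpha> + 1))"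
    using carleson by (auto simp: carleson_measure_def)
  define C1 where "C1 = 2 powr (\<alpha> + 1) * kernel_const 1 (\<alpha> + 1) (\<alpha> + 1) * M"
  define C2 where "C2 = 2 powr (\<alpha> + 1) * kernel_const (p - 1) (\<alpha> + 1) 2"
  define C3 where "C3 = 4 * (M * 3 powr (\<alpha> + 1))"
  define K where "K = C1 powr (p - 1) * C2 * C3"
  have C: "0 < C1" "0 < C2" "0 < C3"
    using M \<alpha> p kernel_const_pos[of 1 "\<alpha> + 1" "\<alpha> + 1"] kernel_const_pos[of "p - 1" 2 "\<alpha> + 1"]
    by (auto simp: C1_def C2_def C3_def)
  then have K: "0 < K"
    by (simp add: K_def)
  have main: "hilbert_op_defined \<mu> \<alpha> f \<and> hilbert_op \<mu> \<alpha> f \<in> bergman_space p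
      \<and> bergman_norm p (hilbert_op \<mu> \<alpha> f) \<le> K powr (1 / p) * bergman_norm p f" if f: "f \<in> bergman_space p" for f
  proof -
    have holf: "f holomorphic_on ball 0 1"
      using f by (simp add: bergman_space_def)
    have [measurable]: "(\<lambda>t. f (of_real t)) \<in> borel_measurable \<mu>"
      by (rule continuous_on_measurable_01[OF \<mu>])
         (rule continuous_on_compose2[OF holomorphic_on_imp_continuous_on[OF holf]], auto intro!: continuous_intros)
    have summ: "summable (\<lambda>k. moment \<mu> k * cmod (taylor_coeff f k))"
      using \<alpha> by (intro summable_moment_taylor_coeff[OF \<mu> _ carleson f p(1)]) auto
    have def: "hilbert_op_defined \<mu> \<alpha> f"
      using \<alpha> by (intro hilbert_op_integral_representation(1)[OF \<mu> fin _ holf summ]) auto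
    define W where "W t = C1 powr (p - 1) * (cmod (f (of_real t)) powr p * (1 - t) powr (p - 1))" for t
    define k where "k t z = cmod (1 - z) powr (- (p - 1)) * cmod (1 - of_real t * z) powr (- (\<alpha> + 1))" for t z
    have [measurable]: "W \<in> borel_measurable \<mu>"
      unfolding W_def by measurable
    have [measurable]: "case_prod k \<in> borel_measurable (\<mu> \<Otimes>\<^sub>M disk_area)"
      unfolding k_def by measurable
    have [measurable]: "k t \<in> borel_measurable disk_area" for t
      unfolding k_def by measurable
    have "(\<integral>\<^sup>+z. cmod (hilbert_op \<mu> \<alpha> f z) powr p \<partial>disk_area)
        \<le> (\<integral>\<^sup>+z. \<integral>\<^sup>+t. ennreal (W t) * ennreal (k t z) \<partial>\<mu> \<partial>disk_area)"
    proof (intro nn_integral_mono)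
      fix z assume "z \<in> space disk_area"
      then have "ennreal (cmod (hilbert_op \<mu> \<alpha> f z) powr p) \<le> (\<integral>\<^sup>+t. C1 powr (p - 1) * (cmod (f (of_real t)) powr p * (1 - t) powr (p - 1)
          * (cmod (1 - z) powr (- (p - 1)) * cmod (1 - of_real t * z) powr (- (\<alpha> + 1)))) \<partial>\<mu>)"
        unfolding C1_def using \<alpha> by (intro hilbert_op_pointwise_bound \<mu> M holf p summ) auto
      also have "\<dots> = (\<integral>\<^sup>+t. ennreal (W t) * ennreal (k t z) \<partial>\<mu>)"
        by (intro nn_integral_cong) (simp add: W_def k_def ennreal_mult[symmetric] mult_ac)
      finally show "ennreal (cmod (hilbert_op \<mu> \<alpha> f z) powr p) \<le> (\<integral>\<^sup>+t. ennreal (W t) * ennreal (k t z) \<partial>\<mu>)" .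
    qed
    also have "\<dots> = (\<integral>\<^sup>+t. \<integral>\<^sup>+z. ennreal (W t) * ennreal (k t z) \<partial>disk_area \<partial>\<mu>)"
      by (rule Fubini') measurable
    also have "\<dots> = (\<integral>\<^sup>+t. ennreal (W t) * (\<integral>\<^sup>+z. k t z \<partial>disk_area) \<partial>\<mu>)"
      by (intro nn_integral_cong nn_integral_cmult) measurable
    also have "\<dots> \<le> (\<integral>\<^sup>+t. ennreal (W t) * ennreal (C2 * (1 - t) powr (2 - (p - 1) - (\<alpha> + 1))) \<partial>\<mu>)"
      unfolding k_def C2_def using p \<alpha>
      by (intro nn_integral_mono mult_left_mono nn_integral_disk_kernel_le) (auto simp: space)
    also have "\<dots> = (\<integral>\<^sup>+t. ennreal (C1 powr (p - 1) * C2) * ennreal (cmod (f (of_real t)) powr p * (1 - t) powr (2 - (\<alpha> + 1))) \<partial>\<mu>)"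
    proof (intro nn_integral_cong)
      fix t assume "t \<in> space \<mu>"
      have "(1 - t) powr (p - 1) * (1 - t) powr (2 - (p - 1) - (\<alpha> + 1)) = (1 - t) powr (2 - (\<alpha> + 1))"
        unfolding powr_add[symmetric] by simp
      then have "W t * (C2 * (1 - t) powr (2 - (p - 1) - (\<alpha> + 1)))
          = C1 powr (p - 1) * C2 * (cmod (f (of_real t)) powr p * (1 - t) powr (2 - (\<alpha> + 1)))"
        by (simp add: W_def mult.assoc mult.left_commute)
      then show "ennreal (W t) * ennreal (C2 * (1 - t) powr (2 - (p - 1) - (\<alpha> + 1)))
          = ennreal (C1 powr (p - 1) * C2) * ennreal (cmod (f (of_real t)) powr p * (1 - t) powr (2 - (\<alpha> + 1)))"
        using C by (simp add: ennreal_mult[symmetric] W_def)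
    qed
    also have "\<dots> = ennreal (C1 powr (p - 1) * C2) * (\<integral>\<^sup>+t. cmod (f (of_real t)) powr p * (1 - t) powr (2 - (\<alpha> + 1)) \<partial>\<mu>)"
      by (rule nn_integral_cmult) measurable
    also have "\<dots> \<le> ennreal (C1 powr (p - 1) * C2) * (ennreal C3 * (\<integral>\<^sup>+z. cmod (f z) powr p \<partial>disk_area))"
      unfolding C3_def using \<alpha> by (intro mult_left_mono carleson_embedding \<mu> M holf p) auto
    also have "\<dots> = ennreal (K * bergman_norm p f powr p)"
      using C p by (simp add: K_def nn_integral_bergman_norm[OF f] ennreal_mult mult.assoc)
    also have "K * bergman_norm p f powr p = (K powr (1 / p) * bergman_norm p f) powr p"
      using K p by (simp add: powr_mult powr_powr bergman_norm_nonneg)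
    finally have le: "(\<integral>\<^sup>+z. cmod (hilbert_op \<mu> \<alpha> f z) powr p \<partial>disk_area) \<le> ennreal ((K powr (1 / p) * bergman_norm p f) powr p)" .
    then have Hf: "hilbert_op \<mu> \<alpha> f \<in> bergman_space p"
      by (intro bergman_spaceI holomorphic_hilbert_op[OF def]) (auto intro: le_less_trans)
    moreover have "bergman_norm p (hilbert_op \<mu> \<alpha> f) \<le> K powr (1 / p) * bergman_norm p f"
      using p bergman_norm_nonneg by (intro bergman_norm_le[OF Hf _ _ le]) auto
    ultimately show ?thesis
      using def by simp
  qed
  moreover have "0 < K powr (1 / p)"
    using K by simp
  ultimately show ?thesis
    unfolding hilbert_op_bounded_on_bergman_def by blast
qed

section \<open>The characterisation of boundedness\<close>

theorem theorem3p8: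
  fixes p \<alpha> :: real and \<mu> :: "real measure"
  assumes "1 \<le> p" and "p \<le> 2" and "\<alpha> > 1"
    and "borel_measure_on_01 \<mu>"
    and "carleson_measure ((2 - (p - 1)\<^sup>2) / p) \<mu>"
  shows "hilbert_op_bounded_on_bergman \<mu> \<alpha> p \<longleftrightarrow> carleson_measure (\<alpha> + 1) \<mu>"
proof
  have "finite_measure \<mu>"
    using assms by (intro carleson_measure_finite)
  then show "carleson_measure (\<alpha> + 1) \<mu>" if "hilbert_op_bounded_on_bergman \<mu> \<alpha> p"
    using assms that by (intro carleson_measure_if_bounded) auto
  show "hilbert_op_bounded_on_bergman \<mu> \<alpha> p" if "carleson_measure (\<alpha> + 1) \<mu>"
    using assms that by (intro bounded_if_carleson_measure) auto
qed

end
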